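(* A minimum spanning forest of a given undirected edge-weighted graph with $n$ vertices and $m$ edges, where the weight of any edge can be represented in $O(\lg n)$ bits, can be found using $n+O(n/f(n))$ bits of working space and $O(m\lg n\, f(n))$ time, for any function $f(n)$ with $1\le f(n)\le n$.
   Context: Model: the input graph (with integer edge weights) is stored in read-only memory as a standard adjacency list, output goes to write-only memory, and only the additional random-access workspace is counted, in bits; the workspace is a word RAM with words of $\Omega(\lg n)$ bits. A minimum spanning forest is a spanning forest (a minimum spanning tree of each connected component) of minimum total edge weight. As a standing assumption of the paper, the input graph is connected (so $m\ge n-1$). *)

theory Defs
  imports Complex_Main
begin

section \<open>Minimum spanning forests\<close>

text \<open>
  A finite simple undirected graph has vertex set \<open>{..<n}\<close> and a set of two-element
  edges.  The session \<open>Graph_Theory\<close> models undirected graphs as symmetric digraphs; its notion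
  of forest is not usable here, as each undirected edge becomes a directed cycle of length two.
\<close>

definition simple_graph :: "nat \<Rightarrow> nat set set \<Rightarrow> bool" where
  "simple_graph n E \<longleftrightarrow> (\<forall>e\<in>E. e \<subseteq> {..<n} \<and> card e = 2)"

definition adj :: "nat set set \<Rightarrow> (nat \<times> nat) set" where
  "adj E = {(u, v). {u, v} \<in> E}"

definition connected_graph :: "nat \<Rightarrow> nat set set \<Rightarrow> bool" where
  "connected_graph n E \<longleftrightarrow> (\<forall>u<n. \<forall>v<n. (u, v) \<in> (adj E)\<^sup>*)"

definition is_cycle :: "nat set set \<Rightarrow> nat list \<Rightarrow> bool" where
  "is_cycle E vs \<longleftrightarrow> 3 \<le> length vs \<and> distinct vs \<and>
     (\<forall>i<length vs. {vs ! i, vs ! (Suc i mod length vs)} \<in> E)"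

definition forest :: "nat set set \<Rightarrow> bool" where
  "forest F \<longleftrightarrow> (\<nexists>vs. is_cycle F vs)"

text \<open>
  Equality of the reachability relations says that \<open>F\<close> connects every connected component
  of \<open>E\<close>, so that \<open>F\<close> restricts to a spanning tree of each component.
\<close>

definition spanning_forest :: "nat set set \<Rightarrow> nat set set \<Rightarrow> bool" where
  "spanning_forest E F \<longleftrightarrow> F \<subseteq> E \<and> forest F \<and> (adj F)\<^sup>* = (adj E)\<^sup>*"

definition min_spanning_forest :: "nat set set \<Rightarrow> (nat set \<Rightarrow> int) \<Rightarrow> nat set set \<Rightarrow> bool" where
  "min_spanning_forest E wt F \<longleftrightarrow> spanning_forest E F \<and>
     (\<forall>F'. spanning_forest E F' \<longrightarrow> sum wt F \<le> sum wt F')"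


section \<open>A word RAM with read-only input and write-only output\<close>

text \<open>
  Words of \<open>w\<close> bits are natural numbers below \<open>2 ^ w\<close>.  A program is a fixed finite term, so
  it uses a constant number of word-sized processor registers; these are not part of the
  random-access workspace.  The workspace is addressed by bits, and one instruction transfers
  a field of at most \<open>w\<close> consecutive bits.  Such a transfer amounts to a constant number of
  operations on aligned words, and it lets the size of the workspace be any number of bits.
  The output memory is filled sequentially and is never read.

  Structured control flow stands for compares and jumps.  Every elementary instruction and
  every evaluated test takes one unit of time.
\<close>

datatype operand = Reg nat | Imm nat

datatype binop = Add | Sub | Mul | Div | Mod | And | Or | Xor | Shl | Shr

datatype comparison = Eq | Less | SLess

datatype prog =
    Skip
  | Move nat operand
  | Op binop nat operand operand
  | Input nat operand                       \<comment> \<open>register, input address\<close>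
  | Load nat operand operand                \<comment> \<open>register, bit address, field length\<close>
  | Store operand operand operand           \<comment> \<open>bit address, field length, value\<close>
  | Output operand
  | Seq prog prog
  | If comparison operand operand prog prog
  | While comparison operand operand prog

record state =
  regs :: "nat \<Rightarrow> nat"
  work :: "nat \<Rightarrow> bool"
  outp :: "nat list"

fun val :: "nat \<Rightarrow> state \<Rightarrow> operand \<Rightarrow> nat" where
  "val w \<sigma> (Reg r) = regs \<sigma> r"
| "val w \<sigma> (Imm k) = k mod 2 ^ w"

fun binop_val :: "nat \<Rightarrow> binop \<Rightarrow> nat \<Rightarrow> nat \<Rightarrow> nat" where
  "binop_val w Add x y = (x + y) mod 2 ^ w"
| "binop_val w Sub x y = nat ((int x - int y) mod 2 ^ w)"
| "binop_val w Mul x y = (x * y) mod 2 ^ w"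
| "binop_val w Div x y = x div y"
| "binop_val w Mod x y = x mod y"
| "binop_val w And x y = Bit_Operations.and x y"
| "binop_val w Or x y = Bit_Operations.or x y"
| "binop_val w Xor x y = Bit_Operations.xor x y"
| "binop_val w Shl x y = (x * 2 ^ y) mod 2 ^ w"
| "binop_val w Shr x y = x div 2 ^ y"

text \<open>\<open>SLess\<close> compares words as signed integers in two's complement.\<close>

fun cmp_val :: "nat \<Rightarrow> comparison \<Rightarrow> nat \<Rightarrow> nat \<Rightarrow> bool" where
  "cmp_val w Eq x y \<longleftrightarrow> x = y"
| "cmp_val w Less x y \<longleftrightarrow> x < y"
| "cmp_val w SLess x y \<longleftrightarrow> signed_take_bit (w - 1) (int x) < signed_take_bit (w - 1) (int y)"

definition set_reg :: "nat \<Rightarrow> nat \<Rightarrow> state \<Rightarrow> state" where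
  "set_reg r x \<sigma> = \<sigma>\<lparr>regs := (regs \<sigma>)(r := x)\<rparr>"

definition load_field :: "state \<Rightarrow> nat \<Rightarrow> nat \<Rightarrow> nat" where
  "load_field \<sigma> a l = (\<Sum>i<l. of_bool (work \<sigma> (a + i)) * 2 ^ i)"

definition store_field :: "nat \<Rightarrow> nat \<Rightarrow> nat \<Rightarrow> state \<Rightarrow> state" where
  "store_field a l x \<sigma> =
     \<sigma>\<lparr>work := (\<lambda>i. if a \<le> i \<and> i < a + l then bit x (i - a) else work \<sigma> i)\<rparr>"

text \<open>
  \<open>exec w s I P \<sigma> t \<sigma>'\<close>: on words of \<open>w\<close> bits, with input memory \<open>I\<close> and a workspace of
  exactly \<open>s\<close> bits, program \<open>P\<close> started in \<open>\<sigma>\<close> halts in \<open>\<sigma>'\<close> after \<open>t\<close> steps.  There is no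
  rule for an access outside the workspace, so a program that attempts one does not halt.
\<close>

inductive exec :: "nat \<Rightarrow> nat \<Rightarrow> (nat \<Rightarrow> nat) \<Rightarrow> prog \<Rightarrow> state \<Rightarrow> nat \<Rightarrow> state \<Rightarrow> bool"
  for w s :: nat and I :: "nat \<Rightarrow> nat" where
  Skip: "exec w s I Skip \<sigma> 1 \<sigma>"
| Move: "exec w s I (Move r x) \<sigma> 1 (set_reg r (val w \<sigma> x) \<sigma>)"
| Op: "exec w s I (Op b r x y) \<sigma> 1 (set_reg r (binop_val w b (val w \<sigma> x) (val w \<sigma> y)) \<sigma>)"
| Input: "exec w s I (Input r x) \<sigma> 1 (set_reg r (I (val w \<sigma> x)) \<sigma>)"
| Load: "val w \<sigma> l \<le> w \<Longrightarrow> val w \<sigma> a + val w \<sigma> l \<le> s \<Longrightarrow>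
    exec w s I (Load r a l) \<sigma> 1 (set_reg r (load_field \<sigma> (val w \<sigma> a) (val w \<sigma> l)) \<sigma>)"
| Store: "val w \<sigma> l \<le> w \<Longrightarrow> val w \<sigma> a + val w \<sigma> l \<le> s \<Longrightarrow>
    exec w s I (Store a l x) \<sigma> 1 (store_field (val w \<sigma> a) (val w \<sigma> l) (val w \<sigma> x) \<sigma>)"
| Output: "exec w s I (Output x) \<sigma> 1 (\<sigma>\<lparr>outp := outp \<sigma> @ [val w \<sigma> x]\<rparr>)"
| Seq: "exec w s I P \<sigma> t \<sigma>' \<Longrightarrow> exec w s I Q \<sigma>' t' \<sigma>'' \<Longrightarrow>
    exec w s I (Seq P Q) \<sigma> (t + t') \<sigma>''"
| IfTrue: "cmp_val w b (val w \<sigma> x) (val w \<sigma> y) \<Longrightarrow> exec w s I P \<sigma> t \<sigma>' \<Longrightarrow>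
    exec w s I (If b x y P Q) \<sigma> (1 + t) \<sigma>'"
| IfFalse: "\<not> cmp_val w b (val w \<sigma> x) (val w \<sigma> y) \<Longrightarrow> exec w s I Q \<sigma> t \<sigma>' \<Longrightarrow>
    exec w s I (If b x y P Q) \<sigma> (1 + t) \<sigma>'"
| WhileFalse: "\<not> cmp_val w b (val w \<sigma> x) (val w \<sigma> y) \<Longrightarrow>
    exec w s I (While b x y P) \<sigma> 1 \<sigma>"
| WhileTrue: "cmp_val w b (val w \<sigma> x) (val w \<sigma> y) \<Longrightarrow> exec w s I P \<sigma> t \<sigma>' \<Longrightarrow>
    exec w s I (While b x y P) \<sigma>' t' \<sigma>'' \<Longrightarrow>
    exec w s I (While b x y P) \<sigma> (1 + t + t') \<sigma>''"

text \<open>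
  Besides \<open>n\<close> in register 0, the program is given the trade-off parameter in register 1.  A
  bound stated for an arbitrary function \<open>f\<close> requires this, since \<open>f\<close> need not be computable.
\<close>

definition init_state :: "nat \<Rightarrow> nat \<Rightarrow> state" where
  "init_state n k = \<lparr>regs = (\<lambda>_. 0)(0 := n, 1 := k), work = (\<lambda>_. False), outp = []\<rparr>"


section \<open>Input and output encoding\<close>

text \<open>
  Cell \<open>u < n\<close> of the input memory holds a pointer to the linked list of the edges at \<open>u\<close>,
  given in any order.  A list node at address \<open>p\<close> has three cells: the neighbour, the weight
  and the pointer to the next node.  As cell 0 is a head cell, 0 serves as the null pointer.
\<close>

fun linked_list :: "nat \<Rightarrow> (nat \<Rightarrow> nat) \<Rightarrow> nat \<Rightarrow> nat \<Rightarrow> (nat \<times> nat) list \<Rightarrow> bool" where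
  "linked_list w I n p [] \<longleftrightarrow> p = 0"
| "linked_list w I n p ((v, x) # xs) \<longleftrightarrow>
     n \<le> p \<and> p + 2 < 2 ^ w \<and> I p = v \<and> I (p + 1) = x \<and> linked_list w I n (I (p + 2)) xs"

text \<open>
  Two's complement.  The encoding is injective on weights representable in fewer than \<open>w\<close>
  bits, which holds for weights of \<open>c lg n\<close> bits once \<open>w \<ge> b lg n\<close> with \<open>b\<close> large enough.
\<close>

definition signed_word :: "nat \<Rightarrow> int \<Rightarrow> nat" where
  "signed_word w z = nat (z mod 2 ^ w)"

definition adjacency_list ::
  "nat \<Rightarrow> (nat \<Rightarrow> nat) \<Rightarrow> nat \<Rightarrow> nat set set \<Rightarrow> (nat set \<Rightarrow> int) \<Rightarrow> bool" where
  "adjacency_list w I n E wt \<longleftrightarrow> n < 2 ^ w \<and> (\<forall>a. I a < 2 ^ w) \<and>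
     (\<forall>u<n. \<exists>vs. distinct vs \<and> set vs = {v. {u, v} \<in> E} \<and>
        linked_list w I n (I u) (map (\<lambda>v. (v, signed_word w (wt {u, v}))) vs))"

text \<open>The output lists every edge of \<open>F\<close> exactly once, as its two end vertices.\<close>

definition encodes_edges :: "nat list \<Rightarrow> nat set set \<Rightarrow> bool" where
  "encodes_edges ws F \<longleftrightarrow> (\<exists>es. ws = concat (map (\<lambda>(u, v). [u, v]) es) \<and>
     distinct (map (\<lambda>(u, v). {u, v}) es) \<and> set (map (\<lambda>(u, v). {u, v}) es) = F)"

end

theory Submission
  imports Defs
begin

text \<open>
  Prim's algorithm.  The vertices are split into \<open>N\<close> blocks of about \<open>k l\<close> vertices, where \<open>k = \<lfloor>f n\<rfloor>\<close> and
  \<open>l = O(lg n)\<close> bits suffice for a weight.  Besides one bit per vertex for membership in the tree, only the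
  least weight of an edge from the tree into each block is kept, in a tournament tree of less than
  \<open>2 N\<close> nodes and hence \<open>O(N l) = O(n / k)\<close> bits.  The root determines a block that contains an end of
  a lightest crossing edge, and scanning the adjacency lists of this block finds the edge.

  Each vertex \<open>u\<close> joins the tree once, at the price of \<open>O(deg u)\<close> updates of the tournament tree and of
  two scans of its block.  A vertex \<open>x\<close> is thus scanned \<open>O(k l)\<close> times, at cost \<open>O(1 + deg x)\<close>, which adds up
  to \<open>O(m k lg n)\<close>.
\<close>

section \<open>Exchanging edges of spanning trees\<close>

text \<open>Cycles are awkward to track through an exchange of edges, so forests are traded for
  counting: a connected graph on \<open>n\<close> vertices is a forest exactly if it has
  \<open>n - 1\<close> edges. An exchange then only has to preserve connectivity and cardinality. A
  block forgets which edge attains its key; the scan recovers it. This is why one key per block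
  suffices. The factor \<open>l\<close> in the block size cancels the length of a key in the space
  bound, and the factor \<open>k\<close> is the actual trade-off. Blocks are residue classes modulo
  \<open>N\<close>. A loop with stride \<open>N\<close> enumerates a block without further storage,
  and "in the block of" is a symmetric relation between vertices, so the sum of all scanning costs
  can be regrouped by the scanned vertex.\<close>

lemma sym_adj: "sym (adj F)"
  by (auto simp: adj_def sym_def insert_commute)

lemma adj_rtrancl_sym: "(u, v) \<in> (adj F)\<^sup>* \<Longrightarrow> (v, u) \<in> (adj F)\<^sup>*"
  using sym_rtrancl[OF sym_adj] by (rule symD)

lemma adj_mono: "F \<subseteq> G \<Longrightarrow> adj F \<subseteq> adj G"
  by (auto simp: adj_def)

lemma adj_rtrancl_mono: "F \<subseteq> G \<Longrightarrow> (u, v) \<in> (adj F)\<^sup>* \<Longrightarrow> (u, v) \<in> (adj G)\<^sup>*"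
  using rtrancl_mono[OF adj_mono] by blast

lemma adj_rtranclI: "{u, v} \<in> F \<Longrightarrow> (u, v) \<in> (adj F)\<^sup>*"
  by (auto simp: adj_def)

text \<open>A walk through the deleted edge takes the detour between its ends instead.\<close>

lemma adj_Diff_rtrancl:
  assumes "(u, v) \<in> (adj (F - {{u, v}}))\<^sup>*" and "(a, b) \<in> (adj F)\<^sup>*"
  shows "(a, b) \<in> (adj (F - {{u, v}}))\<^sup>*"
proof -
  let ?G = "F - {{u, v}}"
  have "(x, y) \<in> (adj ?G)\<^sup>*" if "(x, y) \<in> adj F" for x y
  proof (cases "{x, y} = {u, v}")
    case True
    then have "x = u \<and> y = v \<or> x = v \<and> y = u" by (auto simp: doubleton_eq_iff)
    then show ?thesis using assms(1) adj_rtrancl_sym by blast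
  next
    case False
    then show ?thesis using that by (auto simp: adj_def)
  qed
  then have "adj F \<subseteq> (adj ?G)\<^sup>*" by auto
  then have "(adj F)\<^sup>* \<subseteq> (adj ?G)\<^sup>*" by (metis rtrancl_idemp rtrancl_mono)
  then show ?thesis using assms(2) by blast
qed

section \<open>Paths, cycles and redundant edges\<close>

lemma simple_path:
  assumes "(u, v) \<in> (adj F)\<^sup>*"
  shows "\<exists>xs. xs \<noteq> [] \<and> distinct xs \<and> hd xs = u \<and> last xs = v \<and>
    (\<forall>i. Suc i < length xs \<longrightarrow> {xs ! i, xs ! Suc i} \<in> F)"
  using assms
proof (induction rule: rtrancl_induct)
  case base
  show ?case by (intro exI[of _ "[u]"]) auto
next
  case (step y z)
  then obtain xs where xs: "xs \<noteq> []" "distinct xs" "hd xs = u" "last xs = y"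
    "\<And>i. Suc i < length xs \<Longrightarrow> {xs ! i, xs ! Suc i} \<in> F" by blast
  show ?case
  proof (cases "z \<in> set xs")
    case True
    then obtain k where k: "k < length xs" "xs ! k = z" by (auto simp: in_set_conv_nth)
    \<comment> \<open>A walk that returns to an earlier vertex is cut back to it, which keeps the
      list distinct.\<close>
    let ?ys = "take (Suc k) xs"
    have "last ?ys = z" using k by (simp add: take_Suc_conv_app_nth)
    moreover have "hd ?ys = u" using xs(1,3) by (cases xs) auto
    ultimately show ?thesis using xs k by (intro exI[of _ ?ys]) auto
  next
    case False
    have "{(xs @ [z]) ! i, (xs @ [z]) ! Suc i} \<in> F" if "Suc i < length (xs @ [z])" for i
    proof (cases "Suc i < length xs")
      case True
      then show ?thesis using xs(5) by (simp add: nth_append)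
    next
      case False
      then have i: "i = length xs - 1" using that by simp
      then have "(xs @ [z]) ! i = y" using xs(1,4) by (simp add: nth_append last_conv_nth)
      moreover have "(xs @ [z]) ! Suc i = z" using i xs(1) by (simp add: nth_append)
      ultimately show ?thesis using step(2) by (simp add: adj_def)
    qed
    then show ?thesis using xs False by (intro exI[of _ "xs @ [z]"]) auto
  qed
qed

text \<open>A simple path between the ends that avoids the edge closes up with it to a
  cycle.\<close>

lemma forest_bridge:
  assumes "forest F" "{u, v} \<in> F" "u \<noteq> v"
  shows "(u, v) \<notin> (adj (F - {{u, v}}))\<^sup>*"
proof
  assume "(u, v) \<in> (adj (F - {{u, v}}))\<^sup>*"
  then obtain xs where xs: "xs \<noteq> []" "distinct xs" "hd xs = u" "last xs = v"
    "\<And>i. Suc i < length xs \<Longrightarrow> {xs ! i, xs ! Suc i} \<in> F - {{u, v}}"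
    using simple_path by blast
  have h: "xs ! 0 = u" "xs ! (length xs - 1) = v"
    using xs by (auto simp: hd_conv_nth last_conv_nth)
  have "length xs \<noteq> 0" "length xs \<noteq> 1" using xs(1) h assms(3) by auto
  \<comment> \<open>A path of two vertices would be the deleted edge itself. This yields the length
    3 that \<open>is_cycle\<close> asks for.\<close>
  moreover have "length xs \<noteq> 2" using xs(5)[of 0] h by auto
  ultimately have len: "3 \<le> length xs" by linarith
  have "{xs ! i, xs ! (Suc i mod length xs)} \<in> F" if "i < length xs" for i
  proof (cases "Suc i < length xs")
    case True
    then show ?thesis using xs(5) by simp
  next
    case False
    then have "Suc i = length xs" using that by simp
    then have "xs ! i = v" "xs ! (Suc i mod length xs) = u" using h by (auto simp flip: \<open>Suc i = length xs\<close>)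
    then show ?thesis using assms(2) by (simp add: insert_commute)
  qed
  then have "is_cycle F xs" using len xs(2) by (simp add: is_cycle_def)
  then show False using assms(1) by (auto simp: forest_def)
qed

text \<open>The rest of a cycle joins the ends of its closing edge.\<close>

lemma not_forest_redundant_edge:
  assumes "\<not> forest F"
  obtains u v where "{u, v} \<in> F" "(u, v) \<in> (adj (F - {{u, v}}))\<^sup>*"
proof -
  from assms obtain xs where xs: "3 \<le> length xs" "distinct xs"
    "\<And>i. i < length xs \<Longrightarrow> {xs ! i, xs ! (Suc i mod length xs)} \<in> F"
    by (auto simp: forest_def is_cycle_def)
  let ?m = "length xs - 1"
  let ?G = "F - {{xs ! 0, xs ! ?m}}"
  have "Suc ?m = length xs" using xs(1) by simp
  then have e: "{xs ! 0, xs ! ?m} \<in> F"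
    using xs(3)[of ?m] by (simp add: insert_commute)
  have "(xs ! 0, xs ! j) \<in> (adj ?G)\<^sup>*" if "j < length xs" for j
    using that
  proof (induction j)
    case 0
    show ?case by simp
  next
    case (Suc j)
    have "{xs ! j, xs ! Suc j} \<in> F" using xs(3)[of j] Suc(2) by simp
    \<comment> \<open>With at least three distinct vertices, no other edge of the cycle coincides
      with the closing edge.\<close>
    moreover have "{xs ! j, xs ! Suc j} \<noteq> {xs ! 0, xs ! ?m}"
    proof
      assume "{xs ! j, xs ! Suc j} = {xs ! 0, xs ! ?m}"
      then have "xs ! Suc j = xs ! 0 \<or> xs ! j = xs ! 0 \<and> xs ! Suc j = xs ! ?m"
        by (auto simp: doubleton_eq_iff)
      moreover have "0 < length xs" "j < length xs" "?m < length xs" using xs(1) Suc(2) by linarith+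
      ultimately have "Suc j = 0 \<or> j = 0 \<and> Suc j = ?m"
        using nth_eq_iff_index_eq[OF xs(2)] Suc(2) by simp
      then show False using xs(1) by auto
    qed
    ultimately have "(xs ! j, xs ! Suc j) \<in> adj ?G" by (simp add: adj_def)
    then show ?case using Suc by (meson Suc_lessD rtrancl.rtrancl_into_rtrancl)
  qed
  from this[of ?m] xs(1) have "(xs ! 0, xs ! ?m) \<in> (adj ?G)\<^sup>*" by simp
  with e show thesis by (rule that)
qed

section \<open>Trees grown from vertex 0\<close>

lemma rtrancl_exit:
  assumes "(x, y) \<in> r\<^sup>*" "x \<in> V" "y \<notin> V"
  obtains a b where "a \<in> V" "b \<notin> V" "(a, b) \<in> r"
proof -
  have "y \<in> V \<or> (\<exists>a b. a \<in> V \<and> b \<notin> V \<and> (a, b) \<in> r)"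
    using assms(1) by (induction rule: rtrancl_induct) (use assms(2) in blast)+
  then show thesis using assms(3) that by blast
qed

lemma connected_graph_exit:
  assumes "connected_graph n F" "V \<subseteq> {..<n}" "x \<in> V" "y < n" "y \<notin> V"
  obtains a b where "a \<in> V" "b \<notin> V" "{b, a} \<in> F"
proof -
  have "(x, y) \<in> (adj F)\<^sup>*" using assms by (auto simp: connected_graph_def)
  then obtain a b where "a \<in> V" "b \<notin> V" "(a, b) \<in> adj F"
    using rtrancl_exit[OF _ assms(3,5)] by blast
  then show thesis using that by (simp add: adj_def insert_commute)
qed

text \<open>Acyclicity is encoded by counting: all of \<open>V\<close> is reached from 0 with one
  edge less than there are vertices.\<close>

definition subtree :: "nat \<Rightarrow> nat set set \<Rightarrow> nat set \<Rightarrow> nat set set \<Rightarrow> bool" where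
  "subtree n E V F \<longleftrightarrow> 0 \<in> V \<and> V \<subseteq> {..<n} \<and> F \<subseteq> E \<and> (\<forall>e\<in>F. e \<subseteq> V) \<and>
     finite F \<and> card F + 1 = card V \<and> (\<forall>x\<in>V. (0, x) \<in> (adj F)\<^sup>*)"

lemma subtree_singleton: "0 < n \<Longrightarrow> subtree n E {0} {}"
  by (auto simp: subtree_def)

lemma subtree_extend:
  assumes "subtree n E V F" "v \<in> V" "u < n" "u \<notin> V" "{u, v} \<in> E"
  shows "subtree n E (insert u V) (insert {u, v} F)"
proof -
  have fin: "finite V" using assms(1) by (meson finite_lessThan finite_subset subtree_def)
  have "{u, v} \<notin> F" using assms(1,4) by (auto simp: subtree_def)
  moreover have "(0, x) \<in> (adj (insert {u, v} F))\<^sup>*" if "x \<in> V" for x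
    using assms(1) that adj_rtrancl_mono[of F "insert {u, v} F"]
    by (metis subset_insertI subtree_def)
  moreover have "(v, u) \<in> (adj (insert {u, v} F))\<^sup>*"
    by (rule adj_rtrancl_sym, rule adj_rtranclI) simp
  moreover have "(0, u) \<in> (adj (insert {u, v} F))\<^sup>*"
    using calculation(2)[OF assms(2)] calculation(3) by (rule rtrancl_trans)
  ultimately show ?thesis
    unfolding subtree_def
  proof (intro conjI ballI)
    show "0 \<in> insert u V" "insert u V \<subseteq> {..<n}" "insert {u, v} F \<subseteq> E"
      "finite (insert {u, v} F)"
      using assms by (auto simp: subtree_def)
    show "e \<subseteq> insert u V" if "e \<in> insert {u, v} F" for e
      using assms(1,2) that by (auto simp: subtree_def)
    show "card (insert {u, v} F) + 1 = card (insert u V)"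
      using \<open>{u, v} \<notin> F\<close> assms(1,4) fin by (simp add: subtree_def)
  qed auto
qed

lemma subtree_connected:
  assumes "subtree n E {..<n} F"
  shows "connected_graph n F"
  using assms unfolding subtree_def connected_graph_def
  by (meson adj_rtrancl_sym lessThan_iff rtrancl_trans)

text \<open>In a connected graph some edge leaves any proper vertex set that contains 0, so growth
  never gets stuck. The case \<open>j = n\<close> supplies spanning trees.\<close>

lemma connected_subtree:
  assumes "simple_graph n E" "connected_graph n E" "1 \<le> j" "j \<le> n"
  shows "\<exists>V F. subtree n E V F \<and> card V = j"
  using assms(3,4)
proof (induction j rule: dec_induct)
  case base
  then show ?case using subtree_singleton[of n E] by (intro exI[of _ "{0}"]) auto
next
  case (step j)
  then obtain V F where VF: "subtree n E V F" "card V = j" by auto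
  then have V: "0 \<in> V" "V \<subseteq> {..<n}" "finite V" by (auto simp: subtree_def intro: finite_subset)
  then obtain y where "y < n" "y \<notin> V"
    using VF(2) step by (metis Suc_le_lessD card_lessThan lessThan_iff nless_le subset_antisym subsetI)
  then obtain a b where ab: "a \<in> V" "b \<notin> V" "{b, a} \<in> E"
    using connected_graph_exit[OF assms(2) V(2,1)] by blast
  then have "b < n" using assms(1) by (force simp: simple_graph_def)
  then have "subtree n E (insert b V) (insert {b, a} F)"
    by (rule subtree_extend[OF VF(1) ab(1) _ ab(2,3)])
  moreover have "card (insert b V) = Suc j" using ab(2) V(3) VF(2) by simp
  ultimately show ?case by blast
qed

section \<open>Counting edges of connected graphs\<close>

lemma simple_graph_finite: "simple_graph n E \<Longrightarrow> finite E"
  by (rule finite_subset[of _ "Pow {..<n}"]) (auto simp: simple_graph_def)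

lemma simple_graph_subset: "simple_graph n E \<Longrightarrow> F \<subseteq> E \<Longrightarrow> simple_graph n F"
  by (auto simp: simple_graph_def)

lemma simple_graph_edge:
  assumes "simple_graph n E" "{u, v} \<in> E"
  shows "u < n" "v < n" "u \<noteq> v"
  using assms by (force simp: simple_graph_def)+

lemma connected_spanning_subtree:
  assumes "simple_graph n F" "connected_graph n F" "1 \<le> n"
  obtains T where "T \<subseteq> F" "connected_graph n T" "card T + 1 = n"
proof -
  obtain V T where VT: "subtree n F V T" "card V = n"
    using connected_subtree[OF assms order_refl] by blast
  then have "V = {..<n}" by (intro card_subset_eq) (auto simp: subtree_def)
  with VT have "T \<subseteq> F" "connected_graph n T" "card T + 1 = n"
    using subtree_connected by (auto simp: subtree_def)
  then show thesis by (rule that)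
qed

lemma connected_card_ge:
  assumes "simple_graph n F" "connected_graph n F" "1 \<le> n"
  shows "n \<le> card F + 1"
proof -
  obtain T where "T \<subseteq> F" "card T + 1 = n" using connected_spanning_subtree[OF assms] .
  then show ?thesis using card_mono[OF simple_graph_finite[OF assms(1)]] by fastforce
qed

lemma connected_remove_edge:
  assumes "connected_graph n F" "(u, v) \<in> (adj (F - {{u, v}}))\<^sup>*"
  shows "connected_graph n (F - {{u, v}})"
  using assms(1) adj_Diff_rtrancl[OF assms(2)] by (simp add: connected_graph_def)

text \<open>An edge of \<open>F\<close> outside a spanning subtree \<open>T\<close> would have its
  ends joined by \<open>T\<close>, against \<open>forest_bridge\<close>. Conversely, a redundant
  edge of a cycle could be deleted, leaving too few edges for connectivity.\<close>

lemma connected_forest_iff_card: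
  assumes "simple_graph n F" "connected_graph n F" "1 \<le> n"
  shows "forest F \<longleftrightarrow> card F + 1 = n"
proof
  assume F: "forest F"
  obtain T where T: "T \<subseteq> F" "connected_graph n T" "card T + 1 = n"
    using connected_spanning_subtree[OF assms] .
  have "e \<in> T" if "e \<in> F" for e
  proof (rule ccontr)
    assume "e \<notin> T"
    have "card e = 2" using assms(1) that by (simp add: simple_graph_def)
    then obtain u v where e: "e = {u, v}"
      by (auto simp: card_2_iff)
    then have uv: "u < n" "v < n" "u \<noteq> v" using simple_graph_edge[OF assms(1)] that by auto
    have "T \<subseteq> F - {{u, v}}" using T(1) \<open>e \<notin> T\<close> e by blast
    moreover have "(u, v) \<in> (adj T)\<^sup>*" using T(2) uv by (simp add: connected_graph_def)
    ultimately have "(u, v) \<in> (adj (F - {{u, v}}))\<^sup>*" by (rule adj_rtrancl_mono)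
    then show False using forest_bridge[OF F _ uv(3)] that e by simp
  qed
  with T show "card F + 1 = n" by (metis subsetI subset_antisym)
next
  assume card: "card F + 1 = n"
  show "forest F"
  proof (rule ccontr)
    assume "\<not> forest F"
    then obtain u v where uv: "{u, v} \<in> F" "(u, v) \<in> (adj (F - {{u, v}}))\<^sup>*"
      by (rule not_forest_redundant_edge)
    have "n \<le> card (F - {{u, v}}) + 1"
      using connected_card_ge[OF simple_graph_subset[OF assms(1)] connected_remove_edge[OF assms(2) uv(2)] assms(3)]
      by blast
    moreover have "card (F - {{u, v}}) + 1 = card F"
      using uv(1) simple_graph_finite[OF assms(1)] by (metis Suc_eq_plus1 card.remove)
    ultimately show False using card by simp
  qed
qed

lemma simple_graph_rtrancl:
  assumes "simple_graph n F" "(x, y) \<in> (adj F)\<^sup>*"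
  shows "x = y \<or> x < n \<and> y < n"
  using assms(2) by (induction rule: rtrancl_induct)
    (use simple_graph_edge[OF assms(1)] in \<open>auto simp: adj_def\<close>)

text \<open>The right-hand side depends on \<open>n\<close> alone, so the equality of reachability
  relations in \<open>spanning_forest\<close> amounts to connectivity. The diagonal covers the
  numbers that are not vertices.\<close>

lemma connected_graph_rtrancl:
  assumes "simple_graph n F" "connected_graph n F"
  shows "(adj F)\<^sup>* = {(x, y). x = y \<or> x < n \<and> y < n}"
  using simple_graph_rtrancl[OF assms(1)] assms(2) by (auto simp: connected_graph_def)

lemma spanning_forest_connected:
  assumes "simple_graph n E" "connected_graph n E"
  shows "spanning_forest E F \<longleftrightarrow> F \<subseteq> E \<and> forest F \<and> connected_graph n F"
proof -
  have "(adj F)\<^sup>* = (adj E)\<^sup>* \<longleftrightarrow> connected_graph n F" if "F \<subseteq> E"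
    using connected_graph_rtrancl[OF simple_graph_subset[OF assms(1) that]]
      connected_graph_rtrancl[OF assms] assms(2)
    by (metis connected_graph_def)
  then show ?thesis by (auto simp: spanning_forest_def)
qed

text \<open>The exchanged edge must leave \<open>V\<close> on a walk from \<open>v\<close> to \<open>u\<close>; taking the last such
  edge, either it can be exchanged or it is dispensable, which the induction exploits.\<close>

lemma exchange_edge:
  assumes "finite S" "(v, u) \<in> (adj S)\<^sup>*" "v \<in> V" "u \<notin> V"
  shows "\<exists>a b. a \<in> V \<and> b \<notin> V \<and> {a, b} \<in> S \<and>
    (v, a) \<in> (adj (S - {{a, b}}))\<^sup>* \<and> (b, u) \<in> (adj (S - {{a, b}}))\<^sup>*"
  using assms(1,2)
proof (induction S rule: finite_psubset_induct)
  case (psubset S)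
  \<comment> \<open>\<open>W\<close> collects the vertices outside \<open>V\<close> from which
    \<open>u\<close> is reached without touching \<open>V\<close>. An edge between \<open>W\<close>
    and its complement must have its other end in \<open>V\<close>.\<close>
  define R where "R = {e \<in> S. e \<inter> V = {}}"
  define W where "W = {x. x \<notin> V \<and> (x, u) \<in> (adj R)\<^sup>*}"
  have "u \<in> W" "v \<notin> W" using assms by (auto simp: W_def)
  then obtain b a where ba: "b \<in> W" "a \<notin> W" "(b, a) \<in> adj S"
    using rtrancl_exit[OF adj_rtrancl_sym[OF psubset.prems]] by metis
  have aV: "a \<in> V"
  proof (rule ccontr)
    assume "a \<notin> V"
    then have "(a, b) \<in> adj R" using ba by (auto simp: adj_def R_def W_def insert_commute)
    then have "a \<in> W" using ba(1) \<open>a \<notin> V\<close> by (auto simp: W_def)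
    then show False using ba(2) by simp
  qed
  have bV: "b \<notin> V" and eS: "{a, b} \<in> S"
    using ba by (auto simp: W_def adj_def insert_commute)
  let ?S = "S - {{a, b}}"
  have "R \<subseteq> ?S" using aV by (auto simp: R_def)
  then have bu: "(b, u) \<in> (adj ?S)\<^sup>*" using ba(1) adj_rtrancl_mono by (auto simp: W_def)
  show ?case
  proof (cases "(v, a) \<in> (adj ?S)\<^sup>*")
    case True
    then show ?thesis using aV bV eS bu by blast
  next
    case False
    have "(v, a) \<in> (adj ?S)\<^sup>* \<or> (v, b) \<in> (adj ?S)\<^sup>*"
    proof -
      have "(v, a) \<in> (adj ?S)\<^sup>* \<or> (v, b) \<in> (adj ?S)\<^sup>* \<or> (v, x) \<in> (adj ?S)\<^sup>*"
        if "(v, x) \<in> (adj S)\<^sup>*" for x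
        using that
      proof (induction rule: rtrancl_induct)
        case (step y z)
        then show ?case
        proof (cases "{y, z} = {a, b}")
          case True
          then have "y = a \<or> y = b" by (auto simp: doubleton_eq_iff)
          then show ?thesis using step by blast
        next
          case False
          then have "(y, z) \<in> adj ?S" using step(2) by (auto simp: adj_def)
          then show ?thesis using step.IH by (auto intro: rtrancl_into_rtrancl)
        qed
      qed simp
      from this[OF psubset.prems] show ?thesis
        using rtrancl_trans[OF _ adj_rtrancl_sym[OF bu], of v] by argo
    qed
    with False bu have vu: "(v, u) \<in> (adj ?S)\<^sup>*" by (auto intro: rtrancl_trans)
    have "?S \<subset> S" using eS by blast
    from psubset.IH[OF this vu] obtain a' b' where ab': "a' \<in> V" "b' \<notin> V" "{a', b'} \<in> ?S"
      "(v, a') \<in> (adj (?S - {{a', b'}}))\<^sup>*" "(b', u) \<in> (adj (?S - {{a', b'}}))\<^sup>*"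
      by blast
    have "?S - {{a', b'}} \<subseteq> S - {{a', b'}}" by blast
    with ab' show ?thesis using adj_rtrancl_mono by blast
  qed
qed

section \<open>The invariant of Prim's algorithm\<close>

text \<open>Instead of fixing one minimum spanning tree that extends \<open>F\<close>, every
  competitor \<open>T\<close> is matched by an extension of \<open>F\<close> that is no heavier. The
  existence of a minimum thus never has to be discussed.\<close>

definition prim_inv :: "nat \<Rightarrow> nat set set \<Rightarrow> (nat set \<Rightarrow> int) \<Rightarrow> nat set \<Rightarrow> nat set set \<Rightarrow> bool" where
  "prim_inv n E wt V F \<longleftrightarrow> subtree n E V F \<and>
     (\<forall>T. T \<subseteq> E \<and> connected_graph n T \<and> card T + 1 = n \<longrightarrow>
       (\<exists>T'. F \<subseteq> T' \<and> T' \<subseteq> E \<and> connected_graph n T' \<and> card T' + 1 = n \<and> sum wt T' \<le> sum wt T))"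

lemma prim_inv_start: "0 < n \<Longrightarrow> prim_inv n E wt {0} {}"
  unfolding prim_inv_def using subtree_singleton by blast

text \<open>Cut property: a spanning tree without \<open>{u, v}\<close> joins \<open>v\<close> to
  \<open>u\<close> through some edge \<open>{a, b}\<close> leaving \<open>V\<close>, which is at
  least as heavy and is swapped for \<open>{u, v}\<close>.\<close>

lemma prim_inv_step:
  assumes E: "simple_graph n E" and inv: "prim_inv n E wt V F"
    and uv: "v \<in> V" "u \<notin> V" "{u, v} \<in> E"
    and min: "\<And>a b. a \<in> V \<Longrightarrow> b \<notin> V \<Longrightarrow> {b, a} \<in> E \<Longrightarrow> wt {u, v} \<le> wt {b, a}"
  shows "prim_inv n E wt (insert u V) (insert {u, v} F)"
  unfolding prim_inv_def
proof (intro conjI allI impI)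
  have un: "u < n" "v < n" using simple_graph_edge[OF E uv(3)] by auto
  have st: "subtree n E V F" using inv by (simp add: prim_inv_def)
  show "subtree n E (insert u V) (insert {u, v} F)"
    using subtree_extend[OF st uv(1) un(1) uv(2,3)] .
  fix T assume "T \<subseteq> E \<and> connected_graph n T \<and> card T + 1 = n"
  then obtain S where S: "F \<subseteq> S" "S \<subseteq> E" "connected_graph n S" "card S + 1 = n" "sum wt S \<le> sum wt T"
    using inv unfolding prim_inv_def by blast
  show "\<exists>T'. insert {u, v} F \<subseteq> T' \<and> T' \<subseteq> E \<and> connected_graph n T' \<and> card T' + 1 = n \<and> sum wt T' \<le> sum wt T"
  proof (cases "{u, v} \<in> S")
    case True
    then show ?thesis using S by blast
  next
    case False
    have fin: "finite S" using S(2) simple_graph_finite[OF E] by (rule finite_subset)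
    have "(v, u) \<in> (adj S)\<^sup>*" using S(3) un by (simp add: connected_graph_def)
    from exchange_edge[OF fin this uv(1,2)] obtain a b where ab: "a \<in> V" "b \<notin> V" "{a, b} \<in> S"
      "(v, a) \<in> (adj (S - {{a, b}}))\<^sup>*" "(b, u) \<in> (adj (S - {{a, b}}))\<^sup>*" by blast
    let ?T = "insert {u, v} (S - {{a, b}})"
    have sub: "S - {{a, b}} \<subseteq> ?T" by blast
    \<comment> \<open>\<open>F\<close> lives inside \<open>V\<close>, so it survives the
      exchange.\<close>
    have "{a, b} \<notin> F" using st ab(2) by (auto simp: subtree_def)
    then have FT: "insert {u, v} F \<subseteq> ?T" using S(1) by blast
    have TE: "?T \<subseteq> E" using S(2) uv(3) by blast
    have "{a, b} \<noteq> {u, v}" using False ab(3) by metis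
    then have "insert {u, v} S - {{a, b}} = ?T" by blast
    moreover have "connected_graph n (insert {u, v} S)"
      using S(3) adj_rtrancl_mono[of S "insert {u, v} S"] by (auto simp: connected_graph_def)
    \<comment> \<open>The ends of the removed edge stay joined by the path from \<open>a\<close> to
      \<open>v\<close>, the new edge and the path from \<open>u\<close> to \<open>b\<close>.\<close>
    moreover have "(a, b) \<in> (adj ?T)\<^sup>*"
    proof -
      have "(a, v) \<in> (adj ?T)\<^sup>*" "(u, b) \<in> (adj ?T)\<^sup>*"
        using ab(4,5) adj_rtrancl_mono[OF sub] adj_rtrancl_sym by blast+
      moreover have "(v, u) \<in> (adj ?T)\<^sup>*" by (rule adj_rtrancl_sym, rule adj_rtranclI) simp
      ultimately show ?thesis by (meson rtrancl_trans)
    qed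
    ultimately have conn: "connected_graph n ?T"
      using connected_remove_edge[of n "insert {u, v} S" a b] by simp
    have card: "card ?T + 1 = n"
      using S(4) fin False ab(3) by (metis card_Suc_Diff1 card_insert_disjoint Diff_iff finite_Diff)
    have "sum wt ?T = wt {u, v} + sum wt (S - {{a, b}})" using fin False by simp
    also have "\<dots> \<le> wt {a, b} + sum wt (S - {{a, b}})"
      using min[OF ab(1,2)] ab(3) S(2) by (auto simp: insert_commute)
    also have "\<dots> = sum wt S" using fin ab(3) by (simp add: sum.remove)
    finally show ?thesis using S(5) FT TE conn card by (intro exI[of _ ?T]) auto
  qed
qed

text \<open>Once all vertices are in the tree, \<open>F\<close> has \<open>n - 1\<close> edges, so
  the extension of \<open>F\<close> that matches a competitor is \<open>F\<close> itself.\<close>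

lemma prim_inv_final:
  assumes E: "simple_graph n E" "connected_graph n E" "1 \<le> n" and inv: "prim_inv n E wt {..<n} F"
  shows "min_spanning_forest E wt F"
  unfolding min_spanning_forest_def
proof (intro conjI allI impI)
  have st: "subtree n E {..<n} F" using inv by (simp add: prim_inv_def)
  have F: "F \<subseteq> E" "connected_graph n F" "card F + 1 = n"
    using st subtree_connected[OF st] by (auto simp: subtree_def)
  show "spanning_forest E F"
    using F spanning_forest_connected[OF E(1,2)]
      connected_forest_iff_card[OF simple_graph_subset[OF E(1) F(1)] F(2) E(3)] by simp
  fix T assume "spanning_forest E T"
  then have "T \<subseteq> E" "connected_graph n T" "forest T"
    using spanning_forest_connected[OF E(1,2)] by auto
  then have "T \<subseteq> E \<and> connected_graph n T \<and> card T + 1 = n"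
    using connected_forest_iff_card[OF simple_graph_subset[OF E(1)] _ E(3)] by simp
  then obtain S where S: "F \<subseteq> S" "S \<subseteq> E" "card S + 1 = n" "sum wt S \<le> sum wt T"
    using inv unfolding prim_inv_def by blast
  have "finite S" using S(2) simple_graph_finite[OF E(1)] by (rule finite_subset)
  then have "F = S" using S F by (intro card_subset_eq) auto
  then show "sum wt F \<le> sum wt T" using S(4) by simp
qed

lemma encodes_edges_append:
  assumes "encodes_edges ws F" "{u, v} \<notin> F"
  shows "encodes_edges (ws @ [u, v]) (insert {u, v} F)"
proof -
  from assms(1) obtain es where es: "ws = concat (map (\<lambda>(u, v). [u, v]) es)"
    "distinct (map (\<lambda>(u, v). {u, v}) es)" "set (map (\<lambda>(u, v). {u, v}) es) = F"
    unfolding encodes_edges_def by blast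
  then show ?thesis unfolding encodes_edges_def using assms(2)
    by (intro exI[of _ "es @ [(u, v)]"]) auto
qed

section \<open>Weakest preconditions\<close>

notation Seq (infixr ";;" 60)

definition wp ::
  "nat \<Rightarrow> nat \<Rightarrow> (nat \<Rightarrow> nat) \<Rightarrow> prog \<Rightarrow> (nat \<Rightarrow> state \<Rightarrow> bool) \<Rightarrow> state \<Rightarrow> bool" where
  "wp w s I P Q \<sigma> \<longleftrightarrow> (\<exists>t \<sigma>'. exec w s I P \<sigma> t \<sigma>' \<and> Q t \<sigma>')"

inductive_cases exec_cases:
  "exec w s I Skip \<sigma> t \<sigma>'"
  "exec w s I (Move r x) \<sigma> t \<sigma>'"
  "exec w s I (Op b r x y) \<sigma> t \<sigma>'"
  "exec w s I (Input r x) \<sigma> t \<sigma>'"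
  "exec w s I (Load r a l) \<sigma> t \<sigma>'"
  "exec w s I (Store a l x) \<sigma> t \<sigma>'"
  "exec w s I (Output x) \<sigma> t \<sigma>'"
  "exec w s I (Seq P R) \<sigma> t \<sigma>'"
  "exec w s I (If c x y P R) \<sigma> t \<sigma>'"

inductive_cases exec_WhileE: "exec w s I (While b x y P) \<sigma> t \<sigma>'"

lemma wpI: "exec w s I P \<sigma> t \<sigma>' \<Longrightarrow> Q t \<sigma>' \<Longrightarrow> wp w s I P Q \<sigma>"
  by (auto simp: wp_def)

lemma wpE:
  assumes "wp w s I P Q \<sigma>"
  obtains t \<sigma>' where "exec w s I P \<sigma> t \<sigma>'" "Q t \<sigma>'"
  using assms by (auto simp: wp_def)

lemma wp_simps [simp]:
  "wp w s I Skip Q \<sigma> \<longleftrightarrow> Q (Suc 0) \<sigma>"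
  "wp w s I (Move r x) Q \<sigma> \<longleftrightarrow> Q (Suc 0) (set_reg r (val w \<sigma> x) \<sigma>)"
  "wp w s I (Op b r x y) Q \<sigma> \<longleftrightarrow> Q (Suc 0) (set_reg r (binop_val w b (val w \<sigma> x) (val w \<sigma> y)) \<sigma>)"
  "wp w s I (Input r x) Q \<sigma> \<longleftrightarrow> Q (Suc 0) (set_reg r (I (val w \<sigma> x)) \<sigma>)"
  "wp w s I (Load r a l) Q \<sigma> \<longleftrightarrow> val w \<sigma> l \<le> w \<and> val w \<sigma> a + val w \<sigma> l \<le> s \<and>
     Q (Suc 0) (set_reg r (load_field \<sigma> (val w \<sigma> a) (val w \<sigma> l)) \<sigma>)"
  "wp w s I (Store a l x) Q \<sigma> \<longleftrightarrow> val w \<sigma> l \<le> w \<and> val w \<sigma> a + val w \<sigma> l \<le> s \<and>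
     Q (Suc 0) (store_field (val w \<sigma> a) (val w \<sigma> l) (val w \<sigma> x) \<sigma>)"
  "wp w s I (Output x) Q \<sigma> \<longleftrightarrow> Q (Suc 0) (\<sigma>\<lparr>outp := outp \<sigma> @ [val w \<sigma> x]\<rparr>)"
  "wp w s I (Seq P R) Q \<sigma> \<longleftrightarrow> wp w s I P (\<lambda>t. wp w s I R (\<lambda>t'. Q (t + t'))) \<sigma>"
  "wp w s I (If c x y P R) Q \<sigma> \<longleftrightarrow> (if cmp_val w c (val w \<sigma> x) (val w \<sigma> y)
     then wp w s I P (\<lambda>t. Q (Suc t)) \<sigma> else wp w s I R (\<lambda>t. Q (Suc t)) \<sigma>)"
  by (auto elim!: wpE exec_cases intro: wpI exec.intros[simplified])

text \<open>As a rewrite rule this would unfold forever. Each loop is therefore a constant of its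
  own with a rule for a single round, and its specification is proved by induction.\<close>

lemma wp_While:
  "wp w s I (While b x y P) Q \<sigma> \<longleftrightarrow> (if cmp_val w b (val w \<sigma> x) (val w \<sigma> y)
     then wp w s I P (\<lambda>t. wp w s I (While b x y P) (\<lambda>t'. Q (Suc (t + t')))) \<sigma> else Q (Suc 0) \<sigma>)"
proof
  assume "wp w s I (While b x y P) Q \<sigma>"
  then obtain t \<sigma>' where *: "exec w s I (While b x y P) \<sigma> t \<sigma>'" "Q t \<sigma>'" by (rule wpE)
  from *(1) show "if cmp_val w b (val w \<sigma> x) (val w \<sigma> y)
     then wp w s I P (\<lambda>t. wp w s I (While b x y P) (\<lambda>t'. Q (Suc (t + t')))) \<sigma> else Q (Suc 0) \<sigma>"
    by (rule exec_WhileE) (use *(2) in \<open>auto intro!: wpI\<close>)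
qed (auto split: if_splits elim!: wpE intro: wpI exec.intros[simplified])

lemma wp_mono:
  assumes "wp w s I P Q \<sigma>" and "\<And>t \<sigma>'. Q t \<sigma>' \<Longrightarrow> R t \<sigma>'"
  shows "wp w s I P R \<sigma>"
  using assms by (auto simp: wp_def)

text \<open>Simplification splits a sequence and nests the step counts; this applies one joint
  specification to three programs that have been split.\<close>

lemma wp_seq3_mono:
  assumes "wp w s I (P1 ;; P2 ;; P3) Q \<sigma>"
    and "\<And>t1 t2 t3 \<sigma>'. Q (t1 + (t2 + t3)) \<sigma>' \<Longrightarrow> R t1 t2 t3 \<sigma>'"
  shows "wp w s I P1 (\<lambda>t1. wp w s I P2 (\<lambda>t2. wp w s I P3 (R t1 t2))) \<sigma>"
proof -
  have "wp w s I P1 (\<lambda>t. wp w s I (P2 ;; P3) (\<lambda>t'. Q (t + t'))) \<sigma>"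
    using assms(1) by simp
  then show ?thesis
  proof (rule wp_mono)
    fix t \<sigma>'
    assume "wp w s I (P2 ;; P3) (\<lambda>t'. Q (t + t')) \<sigma>'"
    then have "wp w s I P2 (\<lambda>t2. wp w s I P3 (\<lambda>t3. Q (t + (t2 + t3)))) \<sigma>'" by simp
    then show "wp w s I P2 (\<lambda>t2. wp w s I P3 (R t t2)) \<sigma>'"
      by (elim wp_mono) (rule assms(2))
  qed
qed

section \<open>Updates of registers and bit fields\<close>

lemma set_reg_simps [simp]:
  "regs (set_reg r x \<sigma>) = (regs \<sigma>)(r := x)"
  "work (set_reg r x \<sigma>) = work \<sigma>"
  "outp (set_reg r x \<sigma>) = outp \<sigma>"
  "set_reg r x (set_reg r y \<sigma>) = set_reg r x \<sigma>"
  "load_field (set_reg r x \<sigma>) a l = load_field \<sigma> a l"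
  by (simp_all add: set_reg_def load_field_def)

lemma store_field_simps [simp]:
  "regs (store_field a l x \<sigma>) = regs \<sigma>"
  "outp (store_field a l x \<sigma>) = outp \<sigma>"
  by (simp_all add: store_field_def)

lemma load_field_less: "load_field \<sigma> a l < 2 ^ l"
proof (induction l)
  case (Suc l)
  then show ?case by (simp add: load_field_def)
qed (simp add: load_field_def)

lemma load_store_field:
  assumes "x < 2 ^ l"
  shows "load_field (store_field a l x \<sigma>) a l = x"
proof -
  have "load_field (store_field a l x \<sigma>) a l = (\<Sum>i = 0..<l. push_bit i (of_bool (bit x i)))"
    unfolding load_field_def store_field_def
    by (intro sum.cong) (auto simp: push_bit_eq_mult)
  also have "\<dots> = take_bit l x" by (simp only: take_bit_sum)
  finally show ?thesis using assms by (simp add: take_bit_nat_eq_self)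
qed

lemma load_store_field_disjoint:
  assumes "a + l \<le> b \<or> b + k \<le> a"
  shows "load_field (store_field a l x \<sigma>) b k = load_field \<sigma> b k"
  unfolding load_field_def store_field_def using assms by (intro sum.cong) auto

lemma Sub_nat: "y \<le> x \<Longrightarrow> x < 2 ^ w \<Longrightarrow> binop_val w Sub x y = x - y"
  by (simp flip: of_nat_diff)

section \<open>The program\<close>

text \<open>
  Registers: 0 is \<open>n\<close>, 1 the trade-off parameter \<open>k\<close>, 2 the number \<open>N\<close> of blocks, 3 the number \<open>l\<close> of bits
  of a key, 4 the offset \<open>h = 2 ^ (l - 1)\<close>, 5 the size of the tree, 8 the largest gain found by a scan
  and 6, 7 the end vertices of its edge (6 outside the tree), 9 the scanned vertex, 10 a list
  pointer, 11 a neighbour, 12 a gain, 16 a node of the tournament tree; 13 to 15 are temporary.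

  Bit \<open>v < n\<close> of the workspace marks the vertex \<open>v\<close> as visited.  Node \<open>i\<close> of the tournament tree, with
  children \<open>2 * i\<close> and \<open>2 * i + 1\<close>, takes \<open>l\<close> bits from address \<open>n + (i - 2) * l\<close>; block \<open>b\<close>, the vertices
  congruent to \<open>b\<close> modulo \<open>N\<close>, belongs to leaf \<open>N + b\<close>.  The root is not stored, so that one block needs
  no workspace beyond the \<open>n\<close> bits.

  Instead of a weight \<open>x\<close> a node holds the gain \<open>h - x > 0\<close>, and 0 if there is no crossing edge: the
  workspace, which is initially zero, is then a valid tournament tree for maxima.
\<close>

definition addr :: "nat \<Rightarrow> prog" where
  "addr a = Op Sub 13 (Reg a) (Imm 2) ;; Op Mul 13 (Reg 13) (Reg 3) ;; Op Add 13 (Reg 13) (Reg 0)"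

definition tget :: "nat \<Rightarrow> nat \<Rightarrow> prog" where
  "tget r a = addr a ;; Load r (Reg 13) (Reg 3)"

definition tset :: "nat \<Rightarrow> nat \<Rightarrow> prog" where
  "tset a x = addr a ;; Store (Reg 13) (Reg 3) (Reg x)"

text \<open>After each store, register 12 becomes the maximum of the node and its sibling \<open>xor 1\<close>, which is the
  value of the parent.\<close>

definition assign :: prog where
  "assign = While Less (Imm 1) (Reg 16) (
     tset 16 12 ;; Op Xor 15 (Reg 16) (Imm 1) ;; tget 14 15 ;;
     If Less (Reg 12) (Reg 14) (Move 12 (Reg 14)) Skip ;;
     Op Div 16 (Reg 16) (Imm 2))"

definition visited :: "nat \<Rightarrow> nat \<Rightarrow> prog" where
  "visited r a = Load r (Reg a) (Imm 1)"

definition get_gain :: prog where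
  "get_gain = Op Add 13 (Reg 10) (Imm 1) ;; Input 13 (Reg 13) ;; Op Sub 12 (Reg 4) (Reg 13)"

definition advance :: prog where
  "advance = Op Add 13 (Reg 10) (Imm 2) ;; Input 10 (Reg 13)"

definition scan_list :: prog where
  "scan_list = While Less (Imm 0) (Reg 10) (
     Input 11 (Reg 10) ;; visited 13 11 ;;
     If Eq (Reg 13) (Imm 1)
       (get_gain ;; If Less (Reg 8) (Reg 12) (Move 8 (Reg 12) ;; Move 6 (Reg 9) ;; Move 7 (Reg 11)) Skip)
       Skip ;;
     advance)"

definition scan_loop :: prog where
  "scan_loop = While Less (Reg 9) (Reg 0) (
     visited 13 9 ;; If Eq (Reg 13) (Imm 0) (Input 10 (Reg 9) ;; scan_list) Skip ;;
     Op Add 9 (Reg 9) (Reg 2))"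

definition relax :: prog where
  "relax = While Less (Imm 0) (Reg 10) (
     Input 11 (Reg 10) ;; visited 13 11 ;;
     If Eq (Reg 13) (Imm 0)
       (get_gain ;; Op Mod 16 (Reg 11) (Reg 2) ;; Op Add 16 (Reg 16) (Reg 2) ;;
        If Less (Imm 1) (Reg 16)
          (tget 14 16 ;; If Less (Reg 12) (Reg 14) (Move 12 (Reg 14)) Skip) Skip ;;
        assign)
       Skip ;;
     advance)"

text \<open>
  \<open>relax\<close> updates the keys of all blocks for the edges at the new vertex; the block of that vertex has
  lost a candidate and is rescanned.
\<close>

definition add_vertex :: prog where
  "add_vertex = Store (Reg 6) (Imm 1) (Imm 1) ;; Input 10 (Reg 6) ;; relax ;;
     Op Mod 9 (Reg 6) (Reg 2) ;; Op Add 16 (Reg 9) (Reg 2) ;;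
     Move 8 (Imm 0) ;; scan_loop ;; Move 12 (Reg 8) ;; assign"

definition descend_loop :: prog where
  "descend_loop = While Less (Reg 16) (Reg 2) (
     Op Mul 16 (Reg 16) (Imm 2) ;; tget 14 16 ;; Op Add 15 (Reg 16) (Imm 1) ;; tget 12 15 ;;
     If Less (Reg 14) (Reg 12) (Move 16 (Reg 15)) Skip)"

definition main_loop :: prog where
  "main_loop = While Less (Reg 5) (Reg 0) (
     Move 16 (Imm 1) ;; descend_loop ;; Op Sub 9 (Reg 16) (Reg 2) ;;
     Move 8 (Imm 0) ;; scan_loop ;; Output (Reg 6) ;; Output (Reg 7) ;;
     add_vertex ;; Op Add 5 (Reg 5) (Imm 1))"

definition bit_length_loop :: prog where
  "bit_length_loop = While Less (Imm 0) (Reg 13) (Op Div 13 (Reg 13) (Imm 2) ;; Op Add 3 (Reg 3) (Imm 1))"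

text \<open>Rounding \<open>n / (k * l)\<close> down keeps fewer than \<open>2 * N\<close> nodes of
  \<open>l\<close> bits within \<open>2 * n / k\<close> bits. If the quotient is 0, a single block
  is used, whose tree consists of the unstored root.\<close>

definition setup_regs :: "nat \<Rightarrow> prog" where
  "setup_regs K = Move 13 (Reg 0) ;; Move 3 (Imm 0) ;; bit_length_loop ;;
     Op Mul 3 (Reg 3) (Imm K) ;; Op Sub 13 (Reg 3) (Imm 1) ;; Op Shl 4 (Imm 1) (Reg 13) ;;
     Op Mul 13 (Reg 1) (Reg 3) ;; Op Div 2 (Reg 0) (Reg 13) ;;
     If Eq (Reg 2) (Imm 0) (Move 2 (Imm 1)) Skip"

definition prim :: "nat \<Rightarrow> prog" where
  "prim K = If Less (Imm 1) (Reg 0)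
     (setup_regs K ;; Move 5 (Imm 1) ;; Move 6 (Imm 0) ;; add_vertex ;; main_loop) Skip"

section \<open>Correctness and running time\<close>

lemma wp_bit_length_loop:
  "wp w s I bit_length_loop Q \<sigma> \<longleftrightarrow> (if 0 < regs \<sigma> 13 then
     wp w s I (Op Div 13 (Reg 13) (Imm 2) ;; Op Add 3 (Reg 3) (Imm 1))
     (\<lambda>t. wp w s I bit_length_loop (\<lambda>t'. Q (Suc (t + t')))) \<sigma> else Q (Suc 0) \<sigma>)"
  unfolding bit_length_loop_def by (rule trans[OF wp_While]) simp

text \<open>\<open>L\<close> is the exact bit length of register 13 and drops by one with every
  halving. Since \<open>L - 1\<close> is truncated, the value 0 needs the disjunct
  \<open>L = 0\<close>.\<close>

lemma bit_length_loop_correct: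
  assumes "regs \<sigma> 13 < 2 ^ L" "L = 0 \<or> 2 ^ (L - 1) \<le> regs \<sigma> 13" "regs \<sigma> 3 + L < 2 ^ w" "4 \<le> (2::nat) ^ w"
  shows "wp w s I bit_length_loop (\<lambda>t \<sigma>'. t \<le> 1 + 3 * L \<and> regs \<sigma>' 3 = regs \<sigma> 3 + L \<and>
    regs \<sigma>' 0 = regs \<sigma> 0 \<and> regs \<sigma>' 1 = regs \<sigma> 1 \<and> work \<sigma>' = work \<sigma> \<and> outp \<sigma>' = outp \<sigma>) \<sigma>"
  using assms
proof (induction L arbitrary: \<sigma>)
  case 0
  then show ?case by (subst wp_bit_length_loop) simp
next
  case (Suc L)
  let ?m = "regs \<sigma> 13"
  have m: "2 ^ L \<le> ?m" using Suc.prems(2) by simp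
  then have "0 < ?m" using zero_less_power[of "2::nat" L] by linarith
  have m2: "?m div 2 < 2 ^ L" using Suc.prems(1) by simp
  have "L = 0 \<or> 2 ^ (L - 1) \<le> ?m div 2"
  proof (cases L)
    case (Suc L')
    then show ?thesis using m by simp
  qed simp
  note half = this
  have IH: "wp w s I bit_length_loop (\<lambda>t \<sigma>'. t \<le> 1 + 3 * L \<and> regs \<sigma>' 3 = regs \<sigma> 3 + Suc L \<and>
      regs \<sigma>' 0 = regs \<sigma> 0 \<and> regs \<sigma>' 1 = regs \<sigma> 1 \<and> work \<sigma>' = work \<sigma> \<and> outp \<sigma>' = outp \<sigma>) \<tau>"
    if \<tau>: "regs \<tau> 13 = ?m div 2" "regs \<tau> 3 = Suc (regs \<sigma> 3)" "regs \<tau> 0 = regs \<sigma> 0" "regs \<tau> 1 = regs \<sigma> 1"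
      "work \<tau> = work \<sigma>" "outp \<tau> = outp \<sigma>" for \<tau>
    using Suc.IH[of \<tau>] m2 half Suc.prems(3,4) by (simp add: \<tau> \<tau>(4)[simplified])
  have "w \<noteq> 0" using Suc.prems(4) by (intro notI) simp
  moreover have "2 mod 2 ^ w = (2::nat)" using Suc.prems(4) by (intro mod_less) linarith
  moreover have "Suc (regs \<sigma> 3) mod 2 ^ w = Suc (regs \<sigma> 3)" using Suc.prems(3) by (intro mod_less) linarith
  ultimately show ?case
    using \<open>0 < ?m\<close>
    by (subst wp_bit_length_loop) (simp, rule wp_mono[OF IH]; simp)
qed

lemma setup_regs_correct:
  assumes "n < 2 ^ L" "2 ^ (L - 1) \<le> n" "2 \<le> n" "1 \<le> K" "1 \<le> k" "k * (K * L) < 2 ^ w" "K * L \<le> w"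
    "n < 2 ^ w" "4 \<le> (2::nat) ^ w"
  shows "wp w s I (setup_regs K) (\<lambda>t \<sigma>. t \<le> 20 + 3 * L \<and> regs \<sigma> 0 = n \<and> regs \<sigma> 2 = max 1 (n div (k * (K * L))) \<and>
    regs \<sigma> 3 = K * L \<and> regs \<sigma> 4 = 2 ^ (K * L - 1) \<and> work \<sigma> = (\<lambda>_. False) \<and> outp \<sigma> = []) (init_state n k)"
proof -
  have L: "1 \<le> L" using assms(1,3) by (cases L) auto
  define l where "l = K * L"
  have l: "1 \<le> l" "K \<le> l" "L \<le> l" "L * K = l" using L assms(4) by (auto simp: l_def)
  note lw = assms(6,7)[folded l_def]
  have "l \<le> k * l" using assms(5) by simp
  then have "l < 2 ^ w" using lw(1) by linarith
  then have mods: "K mod 2 ^ w = K" "l mod 2 ^ w = l" "k * l mod 2 ^ w = k * l"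
    using l lw(1) by (auto intro!: mod_less)
  have "w \<noteq> 0" using lw(2) l(1) by linarith
  have sub: "nat ((int l - 1) mod 2 ^ w) = l - Suc 0"
    using Sub_nat[OF l(1) \<open>l < 2 ^ w\<close>] by simp
  have "(2::nat) ^ (l - Suc 0) < 2 ^ w"
    using lw(2) l(1) by (intro power_strict_increasing) auto
  then have shl: "(2::nat) ^ (l - Suc 0) mod 2 ^ w = 2 ^ (l - Suc 0)" by (rule mod_less)
  have loop: "wp w s I bit_length_loop (\<lambda>t \<sigma>'. t \<le> 1 + 3 * L \<and> regs \<sigma>' 3 = L \<and>
    regs \<sigma>' 0 = n \<and> regs \<sigma>' 1 = k \<and> work \<sigma>' = (\<lambda>_. False) \<and> outp \<sigma>' = []) \<tau>"
    if \<tau>: "regs \<tau> 13 = n" "regs \<tau> 3 = 0" "regs \<tau> 0 = n" "regs \<tau> 1 = k" "work \<tau> = (\<lambda>_. False)" "outp \<tau> = []" for \<tau>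
  proof (rule wp_mono[OF bit_length_loop_correct[of \<tau> L]])
    show "regs \<tau> 3 + L < 2 ^ w" using l(3) \<open>l < 2 ^ w\<close> \<tau>(2) by linarith
  qed (use \<tau> assms(1,2,9) in simp_all)
  show ?thesis
    unfolding setup_regs_def l_def[symmetric]
    apply (simp add: init_state_def)
    apply (rule wp_mono[OF loop]; simp add: l(4) mods sub shl \<open>w \<noteq> 0\<close>)
    done
qed

text \<open>\<open>A\<close> fixes the order of every adjacency list. The bound on
  \<open>2 * n\<close> keeps node numbers below \<open>2 * N\<close> and the overshoot
  \<open>x + N\<close> of a block scan within a word, the bound on \<open>s\<close> does so for bit
  addresses.\<close>

locale prim_ram =
  fixes n :: nat and E :: "nat set set" and wt :: "nat set \<Rightarrow> int" and w s :: nat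
    and I :: "nat \<Rightarrow> nat" and N l h :: nat and A :: "nat \<Rightarrow> nat list"
  assumes n2: "2 \<le> n" and simple: "simple_graph n E" and conn: "connected_graph n E"
    and n_w: "2 * n < 2 ^ w" and s_w: "s < 2 ^ w" and s_ge: "n + (2 * N - 2) * l \<le> s"
    and N1: "1 \<le> N" and Nn: "N \<le> n" and l1: "1 \<le> l" and lw: "l \<le> w"
    and h: "h = 2 ^ (l - 1)" and wt_h: "\<And>e. e \<in> E \<Longrightarrow> \<bar>wt e\<bar> < int h"
    and A_dist: "\<And>u. u < n \<Longrightarrow> distinct (A u)"
    and A_set: "\<And>u. u < n \<Longrightarrow> set (A u) = {v. {u, v} \<in> E}"
    and A_list: "\<And>u. u < n \<Longrightarrow>
      linked_list w I n (I u) (map (\<lambda>v. (v, signed_word w (wt {u, v}))) (A u))"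
begin

abbreviation run where "run \<equiv> wp w s I"

definition env :: "state \<Rightarrow> bool" where
  "env \<sigma> \<longleftrightarrow> regs \<sigma> 0 = n \<and> regs \<sigma> 2 = N \<and> regs \<sigma> 3 = l \<and> regs \<sigma> 4 = h"

definition vis :: "state \<Rightarrow> nat set" where
  "vis \<sigma> = {v. v < n \<and> work \<sigma> v}"

text \<open>Because \<open>i - 2\<close> is truncated, nodes 0 and 1 alias node 2; statements about
  stored nodes therefore require an index of at least 2.\<close>

definition node :: "state \<Rightarrow> nat \<Rightarrow> nat" where
  "node \<sigma> i = load_field \<sigma> (n + (i - 2) * l) l"

lemma w2: "2 \<le> w"
proof (rule ccontr)
  assume "\<not> 2 \<le> w"
  then have "(2::nat) ^ w \<le> 2 ^ 1" by (intro power_increasing) auto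
  then show False using n_w n2 by simp
qed

lemma pow_w: "4 \<le> (2::nat) ^ w"
  using power_increasing[OF w2, of "2::nat"] by simp

lemma small_mod [simp]: "2 mod 2 ^ w = (2::nat)" "w \<noteq> 0"
  using pow_w w2 by auto

lemma env_simps [simp]:
  "r \<noteq> 0 \<Longrightarrow> r \<noteq> 2 \<Longrightarrow> r \<noteq> 3 \<Longrightarrow> r \<noteq> 4 \<Longrightarrow> env (set_reg r x \<sigma>) = env \<sigma>"
  "env (store_field a k x \<sigma>) = env \<sigma>"
  "env (\<sigma>\<lparr>outp := ws\<rparr>) = env \<sigma>"
  by (auto simp: env_def)

lemma env_cong: "env \<sigma> \<Longrightarrow> (\<And>r. r < 5 \<Longrightarrow> regs \<tau> r = regs \<sigma> r) \<Longrightarrow> env \<tau>"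
  by (simp add: env_def)

lemma envD [simp]: "env \<sigma> \<Longrightarrow> regs \<sigma> 0 = n" "env \<sigma> \<Longrightarrow> regs \<sigma> 2 = N"
  "env \<sigma> \<Longrightarrow> regs \<sigma> 3 = l" "env \<sigma> \<Longrightarrow> regs \<sigma> 4 = h"
  by (auto simp: env_def)

lemma vis_simps [simp]:
  "vis (set_reg r x \<sigma>) = vis \<sigma>"
  "vis (\<sigma>\<lparr>outp := ws\<rparr>) = vis \<sigma>"
  by (auto simp: vis_def)

lemma node_simps [simp]:
  "node (set_reg r x \<sigma>) = node \<sigma>"
  "node (\<sigma>\<lparr>outp := ws\<rparr>) = node \<sigma>"
  by (auto simp: node_def load_field_def fun_eq_iff)

lemma node_less: "node \<sigma> i < 2 ^ l"
  by (simp add: node_def load_field_less)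

section \<open>Layout and update of the tournament tree\<close>

lemma node_disjoint:
  assumes "2 \<le> i" "2 \<le> j" "i \<noteq> j"
  shows "n + (i - 2) * l + l \<le> n + (j - 2) * l \<or> n + (j - 2) * l + l \<le> n + (i - 2) * l"
proof -
  have *: "n + (i - 2) * l + l \<le> n + (j - 2) * l" if "2 \<le> i" "i < j" for i j
  proof -
    have "Suc (i - 2) * l \<le> (j - 2) * l" using that by (intro mult_right_mono) auto
    then show ?thesis by simp
  qed
  show ?thesis using *[of i j] *[of j i] assms by linarith
qed

lemma store_node [simp]:
  assumes "2 \<le> i" "2 \<le> j" "x < 2 ^ l"
  shows "node (store_field (n + (i - 2) * l) l x \<sigma>) j = (if j = i then x else node \<sigma> j)"
  using load_store_field[OF assms(3)] load_store_field_disjoint[OF node_disjoint[OF assms(1,2)]]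
  by (auto simp: node_def)

lemma vis_store_node [simp]: "vis (store_field (n + a) l x \<sigma>) = vis \<sigma>"
  by (auto simp: vis_def store_field_def)

lemma node_bound:
  assumes "2 \<le> i" "i < 2 * N"
  shows "n + (i - 2) * l + l \<le> s"
proof -
  have "Suc (i - 2) * l \<le> (2 * N - 2) * l" using assms by (intro mult_right_mono) auto
  then show ?thesis using s_ge by simp
qed

lemma wp_addr [simp]:
  assumes "env \<sigma>" "2 \<le> regs \<sigma> a" "regs \<sigma> a < 2 * N"
  shows "run (addr a) Q \<sigma> \<longleftrightarrow> Q (Suc (Suc (Suc 0))) (set_reg 13 (n + (regs \<sigma> a - 2) * l) \<sigma>)"
proof -
  let ?i = "regs \<sigma> a"
  have b: "n + (?i - 2) * l + l \<le> s" using node_bound assms(2,3) .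
  have "?i < 2 ^ w" using assms(3) Nn n_w by linarith
  then have sub: "binop_val w Sub ?i 2 = ?i - 2" using assms(2) by (intro Sub_nat)
  have "(?i - 2) * l < 2 ^ w" "(?i - 2) * l + n < 2 ^ w" using b s_w by linarith+
  then show ?thesis
    using assms by (simp add: addr_def sub add.commute del: binop_val.simps(2))
qed

lemma wp_tget [simp]:
  assumes "env \<sigma>" "2 \<le> regs \<sigma> a" "regs \<sigma> a < 2 * N"
  shows "run (tget r a) Q \<sigma> \<longleftrightarrow>
    Q (Suc (Suc (Suc (Suc 0)))) (set_reg r (node \<sigma> (regs \<sigma> a)) (set_reg 13 (n + (regs \<sigma> a - 2) * l) \<sigma>))"
  using assms lw node_bound[OF assms(2,3)] by (simp add: tget_def node_def)

lemma wp_tset [simp]: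
  assumes "env \<sigma>" "2 \<le> regs \<sigma> a" "regs \<sigma> a < 2 * N" "x \<noteq> 13"
  shows "run (tset a x) Q \<sigma> \<longleftrightarrow>
    Q (Suc (Suc (Suc (Suc 0)))) (store_field (n + (regs \<sigma> a - 2) * l) l (regs \<sigma> x) (set_reg 13 (n + (regs \<sigma> a - 2) * l) \<sigma>))"
  using assms lw node_bound[OF assms(2,3)] by (simp add: tset_def node_def)

text \<open>\<open>X\<close> contains the nodes at which validity is suspended during an
  update.\<close>

definition heap :: "(nat \<Rightarrow> nat) \<Rightarrow> nat set \<Rightarrow> bool" where
  "heap T X \<longleftrightarrow> (\<forall>i. 2 \<le> i \<and> i < N \<and> i \<notin> X \<longrightarrow> T i = max (T (2 * i)) (T (2 * i + 1)))"

lemma xor_1: "Bit_Operations.xor i (Suc 0) = (if even i then Suc i else i - 1)"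
  using xor_one_eq[of i] by simp

lemma wp_assign:
  "run assign Q \<sigma> \<longleftrightarrow> (if Suc 0 < regs \<sigma> 16 then
     run (tset 16 12 ;; Op Xor 15 (Reg 16) (Imm 1) ;; tget 14 15 ;;
       If Less (Reg 12) (Reg 14) (Move 12 (Reg 14)) Skip ;; Op Div 16 (Reg 16) (Imm 2))
     (\<lambda>t. run assign (\<lambda>t'. Q (Suc (t + t')))) \<sigma> else Q (Suc 0) \<sigma>)"
  unfolding assign_def by (rule trans[OF wp_While]) simp

text \<open>The tree may be wrong only at the current node and its parent, and register 12 carries
  the value that the current node ought to have. The store repairs this node, and the maximum with
  the sibling is the value owed to the parent. There are at most \<open>d\<close> levels, each
  costing 13 steps.\<close>

lemma assign_correct:
  assumes "env \<sigma>" "1 \<le> regs \<sigma> 16" "regs \<sigma> 16 < 2 * N" "regs \<sigma> 16 < 2 ^ d" "regs \<sigma> 12 < 2 ^ l"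
    and "heap (node \<sigma>) {regs \<sigma> 16, regs \<sigma> 16 div 2}"
    and "2 \<le> regs \<sigma> 16 \<Longrightarrow> regs \<sigma> 16 < N \<Longrightarrow>
      regs \<sigma> 12 = max (node \<sigma> (2 * regs \<sigma> 16)) (node \<sigma> (2 * regs \<sigma> 16 + 1))"
  shows "run assign (\<lambda>t \<sigma>'. t \<le> 1 + 13 * d \<and> heap (node \<sigma>') {} \<and> vis \<sigma>' = vis \<sigma> \<and> outp \<sigma>' = outp \<sigma> \<and>
    (\<forall>j. N \<le> j \<and> 2 \<le> j \<longrightarrow> node \<sigma>' j = (if j = regs \<sigma> 16 then regs \<sigma> 12 else node \<sigma> j)) \<and>
    (\<forall>r. r < 12 \<longrightarrow> regs \<sigma>' r = regs \<sigma> r)) \<sigma>"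
  using assms
proof (induction d arbitrary: \<sigma>)
  case 0
  then show ?case by simp
next
  case (Suc d)
  let ?i = "regs \<sigma> 16" and ?x = "regs \<sigma> 12"
  show ?case
  proof (cases "?i = 1")
    case True
    then show ?thesis using Suc.prems by (subst wp_assign) (auto simp: heap_def)
  next
    case False
    then have i2: "2 \<le> ?i" using Suc.prems(2) by simp
    define j where "j = Bit_Operations.xor ?i (Suc 0)"
    have j: "2 \<le> j" "j < 2 * N" "j \<noteq> ?i" "j div 2 = ?i div 2"
      using i2 Suc.prems(3) by (auto simp: j_def xor_1 elim!: evenE oddE)
    have ij: "{?i, j} = {2 * (?i div 2), 2 * (?i div 2) + 1}"
      using i2 by (auto simp: j_def xor_1 elim!: evenE oddE)
    have IH: "run assign (\<lambda>t \<sigma>'. t \<le> 1 + 13 * d \<and> heap (node \<sigma>') {} \<and> vis \<sigma>' = vis \<sigma> \<and> outp \<sigma>' = outp \<sigma> \<and>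
        (\<forall>j. N \<le> j \<and> 2 \<le> j \<longrightarrow> node \<sigma>' j = (if j = ?i then ?x else node \<sigma> j)) \<and>
        (\<forall>r. r < 12 \<longrightarrow> regs \<sigma>' r = regs \<sigma> r)) \<tau>"
      if \<tau>: "env \<tau>" "regs \<tau> 16 = ?i div 2" "regs \<tau> 12 = max ?x (node \<sigma> j)" "vis \<tau> = vis \<sigma>" "outp \<tau> = outp \<sigma>"
        "\<And>k. 2 \<le> k \<Longrightarrow> node \<tau> k = (if k = ?i then ?x else node \<sigma> k)" "\<And>r. r < 12 \<Longrightarrow> regs \<tau> r = regs \<sigma> r" for \<tau>
    proof (rule wp_mono[OF Suc.IH[of \<tau>]])
      have "node \<tau> k = max (node \<tau> (2 * k)) (node \<tau> (2 * k + 1))"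
        if "2 \<le> k" "k < N" "k \<noteq> ?i div 2" "k \<noteq> ?i div 2 div 2" for k
      proof (cases "k = ?i")
        case True
        then show ?thesis using Suc.prems(7) that \<tau>(6) by simp
      next
        case False
        have "node \<sigma> k = max (node \<sigma> (2 * k)) (node \<sigma> (2 * k + 1))"
          using Suc.prems(6) that(1,2,3) False by (simp add: heap_def)
        \<comment> \<open>Only the parent has \<open>?i\<close> as a child, so other nodes are not
          affected by the store.\<close>
        moreover have "2 * k \<noteq> ?i" "2 * k + 1 \<noteq> ?i" using that(3) by auto
        ultimately show ?thesis using \<tau>(6) that(1) False by simp
      qed
      then show "heap (node \<tau>) {regs \<tau> 16, regs \<tau> 16 div 2}" by (simp add: heap_def \<tau>)
    next
      have "max ?x (node \<sigma> j) = max (node \<tau> ?i) (node \<tau> j)" using \<tau>(6) i2 j by simp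
      also have "\<dots> = max (node \<tau> (2 * (?i div 2))) (node \<tau> (2 * (?i div 2) + 1))"
        using ij by (auto simp: doubleton_eq_iff max.commute)
      finally show "regs \<tau> 12 = max (node \<tau> (2 * regs \<tau> 16)) (node \<tau> (2 * regs \<tau> 16 + 1))"
        by (simp add: \<tau>)
    qed (use i2 Suc.prems \<tau> in \<open>auto simp: node_less\<close>)
    show ?thesis
      using i2 Suc.prems(1,3,5) j
      by (subst wp_assign) (auto simp flip: j_def intro!: wp_mono[OF IH])
  qed
qed


section \<open>Gains of edges and the scan of one list\<close>

definition gain :: "nat set \<Rightarrow> nat" where
  "gain e = nat (int h - wt e)"

lemma two_h: "2 * h = 2 ^ l"
  using l1 by (simp add: h flip: power_Suc)

lemma gain_bounds:
  assumes "e \<in> E"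
  shows "0 < gain e" "gain e < 2 ^ l"
proof -
  show "0 < gain e" using wt_h[OF assms] by (simp add: gain_def)
  have "int (gain e) < int (2 * h)" using wt_h[OF assms] unfolding gain_def by linarith
  then show "gain e < 2 ^ l" unfolding two_h by simp
qed

text \<open>Reduction modulo \<open>2 ^ w\<close> commutes with the subtraction, and the true
  difference lies strictly between 0 and \<open>2 * h = 2 ^ l\<close>, so decoding the signed weight
  is unnecessary.\<close>

lemma gain_word [simp]:
  assumes "e \<in> E"
  shows "nat ((int h - int (signed_word w (wt e))) mod 2 ^ w) = gain e"
proof -
  have "(int h - int (signed_word w (wt e))) mod 2 ^ w = (int h - wt e) mod 2 ^ w"
    by (simp add: signed_word_def mod_diff_right_eq)
  also have "\<dots> = int h - wt e"
  proof (rule mod_pos_pos_trivial)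
    show "0 \<le> int h - wt e" using wt_h[OF assms] by simp
    have "int h - wt e < int (2 * h)" using wt_h[OF assms] by simp
    also have "int (2 * h) \<le> 2 ^ w" using power_increasing[OF lw, of "2::int"] by (simp add: two_h)
    finally show "int h - wt e < 2 ^ w" .
  qed
  finally show ?thesis by (simp add: gain_def)
qed

lemma gain_le_iff: "e \<in> E \<Longrightarrow> e' \<in> E \<Longrightarrow> gain e \<le> gain e' \<longleftrightarrow> wt e' \<le> wt e"
  using wt_h[of e] wt_h[of e'] by (auto simp: gain_def)

lemma n_s: "n \<le> s"
  using s_ge by simp

lemma wp_visited [simp]:
  assumes "regs \<sigma> a < n"
  shows "run (visited r a) Q \<sigma> \<longleftrightarrow> Q (Suc 0) (set_reg r (of_bool (regs \<sigma> a \<in> vis \<sigma>)) \<sigma>)"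
  using assms n_s w2 by (simp add: visited_def load_field_def vis_def)

text \<open>Gains of edges are positive, so \<open>g = 0\<close> signals the empty set;
  \<open>u\<close> and \<open>v\<close> are then arbitrary leftovers in the registers.\<close>

definition best :: "(nat \<times> nat) set \<Rightarrow> nat \<Rightarrow> nat \<Rightarrow> nat \<Rightarrow> bool" where
  "best S g u v \<longleftrightarrow> S = {} \<and> g = 0 \<or>
     (u, v) \<in> S \<and> g = gain {u, v} \<and> (\<forall>(a, b)\<in>S. gain {a, b} \<le> g)"

lemma best_insert:
  assumes "best S g u v" "{a, b} \<in> E"
  shows "g < gain {a, b} \<Longrightarrow> best (insert (a, b) S) (gain {a, b}) a b"
    and "\<not> g < gain {a, b} \<Longrightarrow> best (insert (a, b) S) g u v"
  using assms(1) gain_bounds(1)[OF assms(2)] by (force simp: best_def)+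

lemma wp_scan_list:
  "run scan_list Q \<sigma> \<longleftrightarrow> (if 0 < regs \<sigma> 10 then
     run (Input 11 (Reg 10) ;; visited 13 11 ;;
     If Eq (Reg 13) (Imm 1)
       (get_gain ;; If Less (Reg 8) (Reg 12) (Move 8 (Reg 12) ;; Move 6 (Reg 9) ;; Move 7 (Reg 11)) Skip)
       Skip ;;
     advance)
     (\<lambda>t. run scan_list (\<lambda>t'. Q (Suc (t + t')))) \<sigma> else Q (Suc 0) \<sigma>)"
  unfolding scan_list_def by (rule trans[OF wp_While]) simp

lemma scan_list_correct:
  assumes "env \<sigma>" "regs \<sigma> 9 = x" "\<And>y. y \<in> set ys \<Longrightarrow> {x, y} \<in> E"
    and "linked_list w I n (regs \<sigma> 10) (map (\<lambda>v. (v, signed_word w (wt {x, v}))) ys)"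
    and "best S (regs \<sigma> 8) (regs \<sigma> 6) (regs \<sigma> 7)"
  shows "run scan_list (\<lambda>t \<sigma>'. t \<le> 1 + 15 * length ys \<and> vis \<sigma>' = vis \<sigma> \<and> node \<sigma>' = node \<sigma> \<and> outp \<sigma>' = outp \<sigma> \<and>
    best (S \<union> {(x, y) |y. y \<in> set ys \<and> y \<in> vis \<sigma>}) (regs \<sigma>' 8) (regs \<sigma>' 6) (regs \<sigma>' 7) \<and>
    (\<forall>r. r < 6 \<longrightarrow> regs \<sigma>' r = regs \<sigma> r) \<and> regs \<sigma>' 9 = regs \<sigma> 9 \<and> regs \<sigma>' 16 = regs \<sigma> 16) \<sigma>"
  using assms
proof (induction ys arbitrary: \<sigma> S)
  case Nil
  then show ?case by (subst wp_scan_list) simp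
next
  case (Cons y ys)
  let ?p = "regs \<sigma> 10"
  have xy: "{x, y} \<in> E" using Cons.prems(3) by simp
  then have "y < n" using simple by (auto simp: simple_graph_def)
  have p: "n \<le> ?p" "?p + 2 < 2 ^ w" "I ?p = y" "I (?p + 1) = signed_word w (wt {x, y})"
    "linked_list w I n (I (?p + 2)) (map (\<lambda>v. (v, signed_word w (wt {x, v}))) ys)"
    using Cons.prems(4) by auto
  let ?S = "if y \<in> vis \<sigma> then insert (x, y) S else S"
  have IH: "run scan_list (\<lambda>t \<sigma>'. t \<le> 1 + 15 * length ys \<and> vis \<sigma>' = vis \<sigma> \<and> node \<sigma>' = node \<sigma> \<and> outp \<sigma>' = outp \<sigma> \<and>
    best (S \<union> {(x, z) |z. z \<in> set (y # ys) \<and> z \<in> vis \<sigma>}) (regs \<sigma>' 8) (regs \<sigma>' 6) (regs \<sigma>' 7) \<and>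
    (\<forall>r. r < 6 \<longrightarrow> regs \<sigma>' r = regs \<sigma> r) \<and> regs \<sigma>' 9 = regs \<sigma> 9 \<and> regs \<sigma>' 16 = regs \<sigma> 16) \<tau>"
    if \<tau>: "env \<tau>" "vis \<tau> = vis \<sigma>" "node \<tau> = node \<sigma>" "outp \<tau> = outp \<sigma>" "regs \<tau> 10 = I (?p + 2)"
      "best ?S (regs \<tau> 8) (regs \<tau> 6) (regs \<tau> 7)"
      "\<And>r. r < 6 \<Longrightarrow> regs \<tau> r = regs \<sigma> r" "regs \<tau> 9 = regs \<sigma> 9" "regs \<tau> 16 = regs \<sigma> 16" for \<tau>
  proof -
    have "S \<union> {(x, z) |z. z \<in> set (y # ys) \<and> z \<in> vis \<sigma>} = ?S \<union> {(x, z) |z. z \<in> set ys \<and> z \<in> vis \<sigma>}"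
      by auto
    then show ?thesis
      using wp_mono[OF Cons.IH[of \<tau> ?S]] \<tau> Cons.prems(2,3) p(5) by simp
  qed
  have mods: "Suc ?p mod 2 ^ w = Suc ?p" "(?p + 2) mod 2 ^ w = ?p + 2" using p(2) by auto
  show ?case
    using Cons.prems(1,2,5) p n2 \<open>y < n\<close> xy best_insert[OF Cons.prems(5) xy]
    by (subst wp_scan_list)
      (auto simp: get_gain_def advance_def mods add.commute intro!: wp_mono[OF IH] split: if_splits)
qed

section \<open>Blocks and crossing edges\<close>

text \<open>The part of a residue class from \<open>x\<close> on is what \<open>scan_loop\<close>
  still has to visit; a whole block is \<open>blk b\<close> with \<open>b < N\<close>.\<close>

definition blk :: "nat \<Rightarrow> nat set" where
  "blk x = {a. x \<le> a \<and> a < n \<and> a mod N = x mod N}"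

lemma finite_blk [simp]: "finite (blk x)"
  by (rule finite_subset[of _ "{..<n}"]) (auto simp: blk_def)

lemma blk_step:
  assumes "x < n"
  shows "blk x = insert x (blk (x + N))" "x \<notin> blk (x + N)"
proof -
  have "x + N \<le> a" if "x \<le> a" "a mod N = x mod N" "a \<noteq> x" for a
  proof -
    from that obtain q where "a = x + N * q" by (metis le_add_diff_inverse mod_eq_dvd_iff_nat dvdE)
    with that show ?thesis by (cases q) auto
  qed
  then show "blk x = insert x (blk (x + N))" using assms by (auto simp: blk_def)
  show "x \<notin> blk (x + N)" using N1 by (simp add: blk_def)
qed

text \<open>The 1 pays for the visit of \<open>a\<close> itself; the list is charged even if
  \<open>a\<close> is in the tree and its list is skipped.\<close>

definition blk_cost :: "nat \<Rightarrow> nat" where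
  "blk_cost x = (\<Sum>a\<in>blk x. 15 * (1 + length (A a)))"

text \<open>Pairs are oriented with the end outside the tree first, as in registers 6 and 7, and it
  is this end that \<open>X\<close> restricts.\<close>

definition crossing :: "nat set \<Rightarrow> nat set \<Rightarrow> (nat \<times> nat) set" where
  "crossing V X = {(a, b). {a, b} \<in> E \<and> a \<in> X - V \<and> b \<in> V}"

lemma wp_scan_loop:
  "run scan_loop Q \<sigma> \<longleftrightarrow> (if regs \<sigma> 9 < regs \<sigma> 0 then
     run (visited 13 9 ;; If Eq (Reg 13) (Imm 0) (Input 10 (Reg 9) ;; scan_list) Skip ;;
       Op Add 9 (Reg 9) (Reg 2))
     (\<lambda>t. run scan_loop (\<lambda>t'. Q (Suc (t + t')))) \<sigma> else Q (Suc 0) \<sigma>)"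
  unfolding scan_loop_def by (rule trans[OF wp_While]) simp

lemma scan_loop_correct:
  assumes "env \<sigma>" "best S (regs \<sigma> 8) (regs \<sigma> 6) (regs \<sigma> 7)" "regs \<sigma> 9 = x"
  shows "run scan_loop (\<lambda>t \<sigma>'. t \<le> 1 + blk_cost x \<and>
    vis \<sigma>' = vis \<sigma> \<and> node \<sigma>' = node \<sigma> \<and> outp \<sigma>' = outp \<sigma> \<and>
    best (S \<union> crossing (vis \<sigma>) (blk x)) (regs \<sigma>' 8) (regs \<sigma>' 6) (regs \<sigma>' 7) \<and>
    (\<forall>r. r < 6 \<longrightarrow> regs \<sigma>' r = regs \<sigma> r) \<and> regs \<sigma>' 16 = regs \<sigma> 16) \<sigma>"
  using assms
proof (induction "n - x" arbitrary: \<sigma> S x rule: less_induct)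
  case less
  show ?case
  proof (cases "x < n")
    case False
    then have "blk x = {}" by (auto simp: blk_def)
    then show ?thesis using less.prems False by (subst wp_scan_loop) (simp add: crossing_def)
  next
    case True
    have sum: "blk_cost x =
        15 * (1 + length (A x)) + blk_cost (x + N)"
      using blk_step[OF True] by (simp add: blk_cost_def)
    let ?S = "S \<union> crossing (vis \<sigma>) {x}"
    have IH: "run scan_loop (\<lambda>t \<sigma>'. t \<le> 1 + blk_cost (x + N) \<and>
        vis \<sigma>' = vis \<sigma> \<and> node \<sigma>' = node \<sigma> \<and> outp \<sigma>' = outp \<sigma> \<and>
        best (S \<union> crossing (vis \<sigma>) (blk x)) (regs \<sigma>' 8) (regs \<sigma>' 6) (regs \<sigma>' 7) \<and>
        (\<forall>r. r < 6 \<longrightarrow> regs \<sigma>' r = regs \<sigma> r) \<and> regs \<sigma>' 16 = regs \<sigma> 16) \<tau>"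
      if \<tau>: "vis \<tau> = vis \<sigma>" "node \<tau> = node \<sigma>" "outp \<tau> = outp \<sigma>" "regs \<tau> 9 = x + N"
        "best ?S (regs \<tau> 8) (regs \<tau> 6) (regs \<tau> 7)"
        "\<And>r. r < 6 \<Longrightarrow> regs \<tau> r = regs \<sigma> r" "regs \<tau> 16 = regs \<sigma> 16" for \<tau>
    proof -
      have "?S \<union> crossing (vis \<sigma>) (blk (x + N)) = S \<union> crossing (vis \<sigma>) (blk x)"
        unfolding blk_step(1)[OF True] by (auto simp: crossing_def)
      moreover have "env \<tau>" using env_cong[OF less.prems(1)] \<tau>(6) by simp
      ultimately show ?thesis
        by (intro wp_mono[OF less.hyps[of "x + N" \<tau> ?S]]) (use True N1 \<tau> in auto)
    qed
    have x: "(x + N) mod 2 ^ w = x + N" using True Nn n_w by simp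
    have S: "?S = (if x \<in> vis \<sigma> then S else S \<union> {(x, y) |y. y \<in> set (A x) \<and> y \<in> vis \<sigma>})"
      using A_set[OF True] by (auto simp: crossing_def)
    have list: "run scan_list (\<lambda>t \<sigma>'. t \<le> 1 + 15 * length (A x) \<and> vis \<sigma>' = vis \<sigma> \<and> node \<sigma>' = node \<sigma> \<and> outp \<sigma>' = outp \<sigma> \<and>
        best (S \<union> {(x, y) |y. y \<in> set (A x) \<and> y \<in> vis \<sigma>}) (regs \<sigma>' 8) (regs \<sigma>' 6) (regs \<sigma>' 7) \<and>
        (\<forall>r. r < 6 \<longrightarrow> regs \<sigma>' r = regs \<sigma> r) \<and> regs \<sigma>' 9 = regs \<sigma> 9 \<and> regs \<sigma>' 16 = regs \<sigma> 16) \<tau>"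
      if "env \<tau>" "vis \<tau> = vis \<sigma>" "node \<tau> = node \<sigma>" "outp \<tau> = outp \<sigma>" "regs \<tau> 10 = I x"
        "\<And>r. r < 10 \<Longrightarrow> regs \<tau> r = regs \<sigma> r" "regs \<tau> 16 = regs \<sigma> 16" for \<tau>
      using that less.prems A_set[OF True] A_list[OF True]
      by (intro wp_mono[OF scan_list_correct[of \<tau> x "A x" S]]) auto
    show ?thesis
    proof (cases "x \<in> vis \<sigma>")
      case True
      then show ?thesis
        using less.prems \<open>x < n\<close> unfolding sum
        by (subst wp_scan_loop) (simp, rule wp_mono[OF IH], simp_all add: x S)
    next
      case False
      then show ?thesis
        using less.prems \<open>x < n\<close> unfolding sum
        by (subst wp_scan_loop)
          (simp, rule wp_mono[OF list], simp_all, rule wp_mono[OF IH], simp_all add: x S)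
    qed
  qed
qed


section \<open>Keys of blocks and their updates\<close>

definition key :: "(nat \<times> nat) set \<Rightarrow> nat" where
  "key S = Max (insert 0 ((\<lambda>(a, b). gain {a, b}) ` S))"

lemma key_empty [simp]: "key {} = 0"
  by (simp add: key_def)

lemma key_insert:
  assumes "finite S"
  shows "key (insert (a, b) S) = max (gain {a, b}) (key S)"
proof -
  have "insert 0 ((\<lambda>(a, b). gain {a, b}) ` insert (a, b) S) =
      insert (gain {a, b}) (insert 0 ((\<lambda>(a, b). gain {a, b}) ` S))" by auto
  then show ?thesis unfolding key_def using assms by (subst \<open>insert 0 _ = _\<close>, subst Max_insert) auto
qed

lemma best_key:
  assumes "best S g u v" "finite S"
  shows "g = key S"
  using assms unfolding best_def key_def by (auto intro!: Max_eqI[symmetric])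

lemma key_less:
  assumes "finite S" "\<And>a b. (a, b) \<in> S \<Longrightarrow> {a, b} \<in> E"
  shows "key S < 2 ^ l"
  unfolding key_def using assms gain_bounds(2) by (subst Max_less_iff) auto

lemma gain_le_key: "finite S \<Longrightarrow> (a, b) \<in> S \<Longrightarrow> gain {a, b} \<le> key S"
  unfolding key_def by (intro Max_ge) force+

lemmas edge_less = simple_graph_edge[OF simple]

lemma finite_crossing [simp]: "finite (crossing V X)"
  by (rule finite_subset[of _ "{..<n} \<times> {..<n}"]) (auto simp: crossing_def edge_less)

lemma mark_simps [simp]:
  assumes "u < n"
  shows "vis (store_field u (Suc 0) (Suc 0) \<sigma>) = insert u (vis \<sigma>)"
    "node (store_field u (Suc 0) (Suc 0) \<sigma>) = node \<sigma>"
  using assms by (auto simp: vis_def node_def store_field_def load_field_def fun_eq_iff bit_0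
    intro!: sum.cong)

text \<open>For \<open>N = 1\<close> the leaf is the root, the loop ends at once, and nothing is
  claimed about stored leaves.\<close>

lemma assign_leaf:
  assumes "env \<sigma>" "regs \<sigma> 16 = N + b" "b < N" "regs \<sigma> 12 < 2 ^ l" "heap (node \<sigma>) {}" "2 * N \<le> 2 ^ d"
  shows "run assign (\<lambda>t \<sigma>'. t \<le> 1 + 13 * d \<and> heap (node \<sigma>') {} \<and> vis \<sigma>' = vis \<sigma> \<and> outp \<sigma>' = outp \<sigma> \<and>
    (2 \<le> N \<longrightarrow> (\<forall>c<N. node \<sigma>' (N + c) = (if c = b then regs \<sigma> 12 else node \<sigma> (N + c)))) \<and>
    (\<forall>r. r < 12 \<longrightarrow> regs \<sigma>' r = regs \<sigma> r)) \<sigma>"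
proof (rule wp_mono[OF assign_correct[of \<sigma> d]])
  show "heap (node \<sigma>) {regs \<sigma> 16, regs \<sigma> 16 div 2}" using assms(5) by (simp add: heap_def)
qed (use assms N1 in simp_all)

lemma wp_relax:
  "run relax Q \<sigma> \<longleftrightarrow> (if 0 < regs \<sigma> 10 then
     run (Input 11 (Reg 10) ;; visited 13 11 ;;
     If Eq (Reg 13) (Imm 0)
       (get_gain ;; Op Mod 16 (Reg 11) (Reg 2) ;; Op Add 16 (Reg 16) (Reg 2) ;;
        If Less (Imm 1) (Reg 16)
          (tget 14 16 ;; If Less (Reg 12) (Reg 14) (Move 12 (Reg 14)) Skip) Skip ;;
        assign)
       Skip ;;
     advance)
     (\<lambda>t. run relax (\<lambda>t'. Q (Suc (t + t')))) \<sigma> else Q (Suc 0) \<sigma>)"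
  unfolding relax_def by (rule trans[OF wp_While]) simp

text \<open>The sets \<open>S b\<close> are arbitrary rather than crossing sets because
  \<open>u\<close> is already marked while the leaf of its own block may still count edges with
  outer end \<open>u\<close>. Per list entry, 22 covers the fixed work and \<open>13 * d\<close> the
  climb to the root.\<close>

lemma relax_correct:
  assumes "env \<sigma>" "regs \<sigma> 6 = u" "\<And>y. y \<in> set ys \<Longrightarrow> {u, y} \<in> E"
    and "linked_list w I n (regs \<sigma> 10) (map (\<lambda>v. (v, signed_word w (wt {u, v}))) ys)"
    and "heap (node \<sigma>) {}" "\<And>b. finite (S b)" "2 * N \<le> 2 ^ d"
    and "2 \<le> N \<longrightarrow> (\<forall>b<N. node \<sigma> (N + b) = key (S b))"
  shows "run relax (\<lambda>t \<sigma>'. t \<le> 1 + (22 + 13 * d) * length ys \<and> vis \<sigma>' = vis \<sigma> \<and> outp \<sigma>' = outp \<sigma> \<and>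
    heap (node \<sigma>') {} \<and>
    (2 \<le> N \<longrightarrow> (\<forall>b<N. node \<sigma>' (N + b) =
      key (S b \<union> {(y, u) |y. y \<in> set ys \<and> y \<notin> vis \<sigma> \<and> y mod N = b}))) \<and>
    (\<forall>r. r < 10 \<longrightarrow> regs \<sigma>' r = regs \<sigma> r)) \<sigma>"
  using assms
proof (induction ys arbitrary: \<sigma> S)
  case Nil
  then show ?case by (subst wp_relax) simp
next
  case (Cons y ys)
  let ?p = "regs \<sigma> 10" and ?g = "gain {u, y}"
  have uy: "{u, y} \<in> E" using Cons.prems(3) by simp
  then have "y < n" by (rule edge_less)
  have p: "n \<le> ?p" "?p + 2 < 2 ^ w" "I ?p = y" "I (?p + 1) = signed_word w (wt {u, y})"
    "linked_list w I n (I (?p + 2)) (map (\<lambda>v. (v, signed_word w (wt {u, v}))) ys)"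
    using Cons.prems(4) by auto
  define S' where "S' = (\<lambda>b. if y \<notin> vis \<sigma> \<and> y mod N = b then insert (y, u) (S b) else S b)"
  define R where "R = (\<lambda>b. S b \<union> {(z, u) |z. z \<in> set (y # ys) \<and> z \<notin> vis \<sigma> \<and> z mod N = b})"
  define T where "T = (22 + 13 * d) * length ys"
  have T: "(22 + 13 * d) * length (y # ys) = 22 + 13 * d + T" by (simp add: T_def)
  have R: "R b = S' b \<union> {(z, u) |z. z \<in> set ys \<and> z \<notin> vis \<sigma> \<and> z mod N = b}" for b
    by (auto simp: R_def S'_def)
  have IH: "run relax (\<lambda>t \<sigma>'. t \<le> 1 + T \<and> vis \<sigma>' = vis \<sigma> \<and> outp \<sigma>' = outp \<sigma> \<and>
      heap (node \<sigma>') {} \<and> (2 \<le> N \<longrightarrow> (\<forall>b<N. node \<sigma>' (N + b) = key (R b))) \<and>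
      (\<forall>r. r < 10 \<longrightarrow> regs \<sigma>' r = regs \<sigma> r)) \<tau>"
    if \<tau>: "vis \<tau> = vis \<sigma>" "outp \<tau> = outp \<sigma>" "regs \<tau> 10 = I (?p + 2)" "heap (node \<tau>) {}"
      "2 \<le> N \<longrightarrow> (\<forall>b<N. node \<tau> (N + b) = key (S' b))"
      "\<And>r. r < 10 \<Longrightarrow> regs \<tau> r = regs \<sigma> r" for \<tau>
  proof -
    have "env \<tau>" using env_cong[OF Cons.prems(1)] \<tau>(6) by simp
    moreover have "finite (S' b)" for b using Cons.prems(6) by (simp add: S'_def)
    ultimately show ?thesis
      unfolding R T_def
      by (intro wp_mono[OF Cons.IH[of \<tau> S']]) (use \<tau> Cons.prems(2,3,7) p(5) in simp_all)
  qed
  have b: "y mod N < N" using N1 by simp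
  have mods: "Suc ?p mod 2 ^ w = Suc ?p" "(?p + 2) mod 2 ^ w = ?p + 2"
    "(y mod N + N) mod 2 ^ w = y mod N + N"
    using b Nn n_w p(2) by auto
  have goal: "run relax (\<lambda>t \<sigma>'. t \<le> 1 + (22 + 13 * d + T) \<and> vis \<sigma>' = vis \<sigma> \<and> outp \<sigma>' = outp \<sigma> \<and>
      heap (node \<sigma>') {} \<and> (2 \<le> N \<longrightarrow> (\<forall>b<N. node \<sigma>' (N + b) = key (R b))) \<and>
      (\<forall>r. r < 10 \<longrightarrow> regs \<sigma>' r = regs \<sigma> r)) \<sigma>"
  proof (cases "y \<in> vis \<sigma>")
    case True
    then have "S' = S" by (simp add: S'_def)
    show ?thesis
      using Cons.prems(1,5,8) p n2 \<open>y < n\<close> True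
      by (subst wp_relax)
        (simp add: advance_def mods, rule wp_mono[OF IH], simp_all add: \<open>S' = S\<close>)
  next
    case False
    have asg: "run assign (\<lambda>t \<sigma>'. t \<le> 1 + 13 * d \<and> heap (node \<sigma>') {} \<and> vis \<sigma>' = vis \<sigma> \<and> outp \<sigma>' = outp \<sigma> \<and>
       (2 \<le> N \<longrightarrow> (\<forall>c<N. node \<sigma>' (N + c) = key (S' c))) \<and>
       (\<forall>r. r < 11 \<longrightarrow> regs \<sigma>' r = regs \<sigma> r)) \<tau>"
      if \<tau>: "env \<tau>" "regs \<tau> 16 = y mod N + N"
        "regs \<tau> 12 = (if Suc 0 < y mod N + N then max ?g (node \<sigma> (y mod N + N)) else ?g)"
        "vis \<tau> = vis \<sigma>" "node \<tau> = node \<sigma>" "outp \<tau> = outp \<sigma>"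
        "\<And>r. r < 11 \<Longrightarrow> regs \<tau> r = regs \<sigma> r" for \<tau>
    proof (rule wp_mono[OF assign_leaf[OF \<tau>(1) _ b _ _ Cons.prems(7)]])
      show "regs \<tau> 12 < 2 ^ l" using gain_bounds(2)[OF uy] node_less by (simp add: \<tau>(3))
      show "heap (node \<tau>) {}" using Cons.prems(5) \<tau>(5) by simp
      show "regs \<tau> 16 = N + y mod N" using \<tau>(2) by simp
      fix t \<sigma>'
      assume *: "t \<le> 1 + 13 * d \<and> heap (node \<sigma>') {} \<and> vis \<sigma>' = vis \<tau> \<and> outp \<sigma>' = outp \<tau> \<and>
        (2 \<le> N \<longrightarrow> (\<forall>c<N. node \<sigma>' (N + c) = (if c = y mod N then regs \<tau> 12 else node \<tau> (N + c)))) \<and>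
        (\<forall>r<12. regs \<sigma>' r = regs \<tau> r)"
      have "node \<sigma>' (N + c) = key (S' c)" if "2 \<le> N" "c < N" for c
      proof -
        have c: "node \<sigma>' (N + c) = (if c = y mod N then regs \<tau> 12 else node \<tau> (N + c))"
          "node \<sigma> (N + c) = key (S c)"
          using * Cons.prems(8) that by blast+
        show ?thesis
        proof (cases "c = y mod N")
          case True
          have "regs \<tau> 12 = max ?g (node \<sigma> (N + c))"
            unfolding \<tau>(3) using that(1) by (simp add: True add.commute)
          then show ?thesis
            using c True False key_insert[OF Cons.prems(6)[of c], of y u]
            by (simp add: S'_def insert_commute)
        next
          case False
          then show ?thesis using c \<tau>(5) by (simp add: S'_def)
        qed
      qed
      then show "t \<le> 1 + 13 * d \<and> heap (node \<sigma>') {} \<and> vis \<sigma>' = vis \<sigma> \<and> outp \<sigma>' = outp \<sigma> \<and>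
        (2 \<le> N \<longrightarrow> (\<forall>c<N. node \<sigma>' (N + c) = key (S' c))) \<and> (\<forall>r<11. regs \<sigma>' r = regs \<sigma> r)"
        using * \<tau>(4,6,7) by simp
    qed
    show ?thesis
      using Cons.prems(1,5) p n2 \<open>y < n\<close> False b uy
      by (subst wp_relax)
        (simp add: advance_def mods get_gain_def,
          intro conjI impI; rule wp_mono[OF asg]; simp; rule wp_mono[OF IH]; simp)
  qed
  show ?case
    unfolding T using goal unfolding R_def .
qed


section \<open>Adding a vertex\<close>

definition keys :: "nat set \<Rightarrow> state \<Rightarrow> bool" where
  "keys V \<sigma> \<longleftrightarrow> heap (node \<sigma>) {} \<and> (2 \<le> N \<longrightarrow> (\<forall>b<N. node \<sigma> (N + b) = key (crossing V (blk b))))"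

definition add_cost :: "nat \<Rightarrow> nat \<Rightarrow> nat" where
  "add_cost d u = 15 + 13 * d + (22 + 13 * d) * length (A u) + blk_cost (u mod N)"

lemma blk_eq: "b < N \<Longrightarrow> blk b = {a. a < n \<and> a mod N = b}"
  by (auto simp: blk_def)

text \<open>When \<open>u\<close> joins, the pairs that disappear have outer end \<open>u\<close>
  and hence lie in the block of \<open>u\<close>; every other block only gains pairs ending in
  \<open>u\<close>.\<close>

lemma crossing_insert:
  assumes "b < N" "b \<noteq> u mod N" "u < n"
  shows "crossing (insert u V) (blk b) =
    crossing V (blk b) \<union> {(y, u) |y. y \<in> set (A u) \<and> y \<notin> insert u V \<and> y mod N = b}"
proof -
  have "{y, u} \<in> E \<longleftrightarrow> y \<in> set (A u)" for y using A_set[OF assms(3)] by (simp add: insert_commute)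
  moreover from this have "y < n" if "y \<in> set (A u)" for y using that edge_less by blast
  ultimately show ?thesis
    unfolding blk_eq[OF assms(1)] using assms(2) by (auto simp: crossing_def)
qed

lemma add_vertex_correct:
  assumes "env \<sigma>" "regs \<sigma> 6 = u" "u < n" "keys (vis \<sigma>) \<sigma>" "2 * N \<le> 2 ^ d"
  shows "run add_vertex (\<lambda>t \<sigma>'. t \<le> add_cost d u \<and> vis \<sigma>' = insert u (vis \<sigma>) \<and> outp \<sigma>' = outp \<sigma> \<and>
    keys (insert u (vis \<sigma>)) \<sigma>' \<and> (\<forall>r. r < 6 \<longrightarrow> regs \<sigma>' r = regs \<sigma> r)) \<sigma>"
proof -
  let ?V = "insert u (vis \<sigma>)"
  define T where "T = (22 + 13 * d) * length (A u)"
  \<comment> \<open>This is what the leaves represent after \<open>relax\<close>. It can be out of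
    date only for the block of \<open>u\<close>, whose key \<open>scan_loop\<close>
    recomputes.\<close>
  define S where "S = (\<lambda>b. crossing (vis \<sigma>) (blk b) \<union> {(y, u) |y. y \<in> set (A u) \<and> y \<notin> ?V \<and> y mod N = b})"
  define b where "b = u mod N"
  have b: "b < N" using N1 by (simp add: b_def)
  have S: "S c = crossing ?V (blk c)" if "c < N" "c \<noteq> b" for c
    using crossing_insert[OF that(1)] that(2) assms(3) by (simp add: S_def b_def)
  have u: "u mod 2 ^ w = u" "(b + N) mod 2 ^ w = b + N" using b assms(3) Nn n_w by auto
  have relax: "run relax (\<lambda>t \<sigma>'. t \<le> 1 + T \<and> env \<sigma>' \<and> vis \<sigma>' = ?V \<and> outp \<sigma>' = outp \<sigma> \<and>
      heap (node \<sigma>') {} \<and> (2 \<le> N \<longrightarrow> (\<forall>b<N. node \<sigma>' (N + b) = key (S b))) \<and>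
      (\<forall>r. r < 7 \<longrightarrow> regs \<sigma>' r = regs \<sigma> r)) \<tau>"
    if \<tau>: "env \<tau>" "vis \<tau> = ?V" "outp \<tau> = outp \<sigma>" "node \<tau> = node \<sigma>" "regs \<tau> 10 = I u"
      "\<And>r. r < 7 \<Longrightarrow> regs \<tau> r = regs \<sigma> r" for \<tau>
    unfolding T_def S_def
    by (rule wp_mono[OF relax_correct[of \<tau> u "A u" "\<lambda>b. crossing (vis \<sigma>) (blk b)" d]])
      (use \<tau> assms A_set[OF assms(3)] A_list[OF assms(3)] in \<open>simp_all add: keys_def env_cong[OF \<tau>(1)]\<close>)
  have scan: "run scan_loop (\<lambda>t \<sigma>'. t \<le> 1 + blk_cost b \<and> env \<sigma>' \<and> vis \<sigma>' = ?V \<and> outp \<sigma>' = outp \<sigma> \<and>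
      node \<sigma>' = node \<tau> \<and> regs \<sigma>' 8 = key (crossing ?V (blk b)) \<and> regs \<sigma>' 16 = b + N \<and>
      (\<forall>r. r < 6 \<longrightarrow> regs \<sigma>' r = regs \<sigma> r)) \<tau>"
    if \<tau>: "env \<tau>" "vis \<tau> = ?V" "outp \<tau> = outp \<sigma>" "regs \<tau> 9 = b" "regs \<tau> 8 = 0" "regs \<tau> 16 = b + N"
      "\<And>r. r < 6 \<Longrightarrow> regs \<tau> r = regs \<sigma> r" for \<tau>
  proof (rule wp_mono[OF scan_loop_correct[of \<tau> "{}" b]])
    show "best {} (regs \<tau> 8) (regs \<tau> 6) (regs \<tau> 7)" using \<tau>(5) by (simp add: best_def)
  qed (use \<tau> in \<open>auto dest: best_key intro: env_cong[OF \<tau>(1)]\<close>)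
  have asg: "run assign (\<lambda>t \<sigma>'. t \<le> 1 + 13 * d \<and> vis \<sigma>' = ?V \<and> outp \<sigma>' = outp \<sigma> \<and>
      keys ?V \<sigma>' \<and> (\<forall>r. r < 6 \<longrightarrow> regs \<sigma>' r = regs \<sigma> r)) \<tau>"
    if \<tau>: "env \<tau>" "vis \<tau> = ?V" "outp \<tau> = outp \<sigma>" "regs \<tau> 16 = b + N"
      "regs \<tau> 12 = key (crossing ?V (blk b))" "heap (node \<tau>) {}"
      "2 \<le> N \<longrightarrow> (\<forall>b<N. node \<tau> (N + b) = key (S b))"
      "\<And>r. r < 6 \<Longrightarrow> regs \<tau> r = regs \<sigma> r" for \<tau>
  proof (rule wp_mono[OF assign_leaf[OF \<tau>(1) _ b _ \<tau>(6) assms(5)]])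
    show "regs \<tau> 16 = N + b" using \<tau>(4) by simp
    show "regs \<tau> 12 < 2 ^ l" unfolding \<tau>(5) by (rule key_less[OF finite_crossing]) (auto simp: crossing_def)
  qed (use \<tau> S in \<open>auto simp: keys_def\<close>)
  have cost: "add_cost d u = 15 + 13 * d + T + blk_cost b" by (simp add: add_cost_def T_def b_def)
  have "u + 1 \<le> s" using n_s assms(3) by simp
  then show ?thesis
    using assms(1,2,3) w2 b unfolding cost
    apply (simp add: add_vertex_def u flip: b_def)
    apply (rule wp_mono[OF relax]; simp add: u flip: b_def)
    apply (rule wp_mono[OF scan]; simp)
    apply (rule wp_mono[OF asg]; simp)
    done
qed


section \<open>Locating a lightest crossing edge\<close>

text \<open>Values do not decrease on the way up; as the root is not stored, the climb ends at its
  children.\<close>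

lemma heap_max:
  assumes "heap T {}" "2 \<le> j" "j < 2 * N"
  shows "T j \<le> max (T 2) (T 3)"
  using assms(2,3)
proof (induction j rule: less_induct)
  case (less j)
  show ?case
  proof (cases "j < 4")
    case True
    then have "j = 2 \<or> j = 3" using less.prems(1) by auto
    then show ?thesis by auto
  next
    case False
    let ?i = "j div 2"
    have i: "2 \<le> ?i" "?i < N" "?i < j" using False less.prems by auto
    have "j = 2 * ?i \<or> j = 2 * ?i + 1" by auto
    then have "T j \<le> max (T (2 * ?i)) (T (2 * ?i + 1))" by (metis max.cobounded1 max.cobounded2)
    also have "\<dots> = T ?i" using assms(1) i by (simp add: heap_def)
    also have "\<dots> \<le> max (T 2) (T 3)" using less.IH[of ?i] i by simp
    finally show ?thesis .
  qed
qed

lemma wp_descend_loop: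
  "run descend_loop Q \<sigma> \<longleftrightarrow> (if regs \<sigma> 16 < regs \<sigma> 2 then
     run (Op Mul 16 (Reg 16) (Imm 2) ;; tget 14 16 ;; Op Add 15 (Reg 16) (Imm 1) ;; tget 12 15 ;;
     If Less (Reg 14) (Reg 12) (Move 16 (Reg 15)) Skip)
     (\<lambda>t. run descend_loop (\<lambda>t'. Q (Suc (t + t')))) \<sigma> else Q (Suc 0) \<sigma>)"
  unfolding descend_loop_def by (rule trans[OF wp_While]) simp

text \<open>The current node attains the overall maximum, unless it is the root, and the larger
  child inherits this. Each step down at least doubles the node number, so
  \<open>N <= regs 16 * 2 ^ d\<close> bounds the remaining levels by \<open>d\<close>.\<close>

lemma descend_loop_correct:
  assumes "env \<sigma>" "heap (node \<sigma>) {}" "1 \<le> regs \<sigma> 16" "regs \<sigma> 16 < 2 * N" "N \<le> regs \<sigma> 16 * 2 ^ d"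
    and "regs \<sigma> 16 \<noteq> 1 \<longrightarrow> (\<forall>j. 2 \<le> j \<and> j < 2 * N \<longrightarrow> node \<sigma> j \<le> node \<sigma> (regs \<sigma> 16))"
  shows "run descend_loop (\<lambda>t \<sigma>'. t \<le> 1 + 14 * d \<and> vis \<sigma>' = vis \<sigma> \<and> node \<sigma>' = node \<sigma> \<and> outp \<sigma>' = outp \<sigma> \<and>
    N \<le> regs \<sigma>' 16 \<and> regs \<sigma>' 16 < 2 * N \<and>
    (2 \<le> N \<longrightarrow> (\<forall>j. 2 \<le> j \<and> j < 2 * N \<longrightarrow> node \<sigma> j \<le> node \<sigma> (regs \<sigma>' 16))) \<and>
    (\<forall>r. r < 12 \<longrightarrow> regs \<sigma>' r = regs \<sigma> r)) \<sigma>"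
  using assms
proof (induction d arbitrary: \<sigma>)
  case 0
  then show ?case by (subst wp_descend_loop) auto
next
  case (Suc d)
  let ?i = "regs \<sigma> 16"
  show ?case
  proof (cases "?i < N")
    case False
    then show ?thesis using Suc.prems by (subst wp_descend_loop) auto
  next
    case True
    let ?M = "max (node \<sigma> (2 * ?i)) (node \<sigma> (2 * ?i + 1))"
    have M: "node \<sigma> j \<le> ?M" if "2 \<le> j" "j < 2 * N" for j
    proof (cases "?i = 1")
      case True
      then show ?thesis using heap_max[OF Suc.prems(2) that] by (simp add: numeral_3_eq_3)
    next
      case False
      then have "node \<sigma> ?i = ?M"
        using Suc.prems(2,3) \<open>?i < N\<close> by (simp add: heap_def)
      then show ?thesis using Suc.prems(6) False that by metis
    qed
    have IH: "run descend_loop (\<lambda>t \<sigma>'. t \<le> 1 + 14 * d \<and> vis \<sigma>' = vis \<sigma> \<and> node \<sigma>' = node \<sigma> \<and> outp \<sigma>' = outp \<sigma> \<and>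
      N \<le> regs \<sigma>' 16 \<and> regs \<sigma>' 16 < 2 * N \<and>
      (2 \<le> N \<longrightarrow> (\<forall>j. 2 \<le> j \<and> j < 2 * N \<longrightarrow> node \<sigma> j \<le> node \<sigma> (regs \<sigma>' 16))) \<and>
      (\<forall>r. r < 12 \<longrightarrow> regs \<sigma>' r = regs \<sigma> r)) \<tau>"
      if \<tau>: "vis \<tau> = vis \<sigma>" "node \<tau> = node \<sigma>" "outp \<tau> = outp \<sigma>"
        "regs \<tau> 16 = ?i * 2 \<or> regs \<tau> 16 = Suc (?i * 2)" "node \<sigma> (regs \<tau> 16) = ?M"
        "\<And>r. r < 12 \<Longrightarrow> regs \<tau> r = regs \<sigma> r" for \<tau>
    proof (rule wp_mono[OF Suc.IH[of \<tau>]])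
      show "env \<tau>" by (rule env_cong[OF Suc.prems(1)]) (simp add: \<tau>)
      show "heap (node \<tau>) {}" using Suc.prems(2) \<tau>(2) by simp
      show "1 \<le> regs \<tau> 16" "regs \<tau> 16 < 2 * N" using \<tau>(4) True Suc.prems(3) by auto
      have "?i * 2 * 2 ^ d \<le> regs \<tau> 16 * 2 ^ d" using \<tau>(4) by (intro mult_right_mono) auto
      then show "N \<le> regs \<tau> 16 * 2 ^ d"
        using order_trans[OF Suc.prems(5)] by (simp only: power_Suc mult.assoc)
      show "regs \<tau> 16 \<noteq> 1 \<longrightarrow> (\<forall>j. 2 \<le> j \<and> j < 2 * N \<longrightarrow> node \<tau> j \<le> node \<tau> (regs \<tau> 16))"
      proof (intro impI allI)
        fix j assume "2 \<le> j \<and> j < 2 * N"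
        then show "node \<tau> j \<le> node \<tau> (regs \<tau> 16)" unfolding \<tau>(2,5) using M by blast
      qed
    qed (use \<tau> in simp)
    have "Suc (?i * 2) < 2 ^ w" using True Nn n_w by linarith
    then have "?i * 2 mod 2 ^ w = ?i * 2" "Suc (?i * 2) mod 2 ^ w = Suc (?i * 2)" by simp_all
    then show ?thesis
      using Suc.prems(1,3) True
      by (subst wp_descend_loop)
        (simp, intro conjI impI; rule wp_mono[OF IH]; simp add: max_def mult.commute[of _ 2])
  qed
qed

text \<open>The gain of any crossing edge is at most the key of its block and thus at most that of
  block \<open>j\<close>; comparing gains reverses the comparison of weights.\<close>

lemma best_crossing:
  assumes "0 \<in> V" "V \<subseteq> {..<n}" "V \<noteq> {..<n}" "j < N"
    and "2 \<le> N \<longrightarrow> (\<forall>b<N. key (crossing V (blk b)) \<le> key (crossing V (blk j)))"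
    and "best (crossing V (blk j)) g u v"
  shows "u \<notin> V" "u < n" "v \<in> V" "{u, v} \<in> E" "u mod N = j"
    and "\<And>a b. a \<in> V \<Longrightarrow> b \<notin> V \<Longrightarrow> {b, a} \<in> E \<Longrightarrow> wt {u, v} \<le> wt {b, a}"
proof -
  have g: "g = key (crossing V (blk j))" using best_key[OF assms(6)] by simp
  have le: "gain {b, a} \<le> g" if "a \<in> V" "b \<notin> V" "{b, a} \<in> E" for a b
  proof -
    have b: "b mod N < N" "b < n" using N1 edge_less(1)[OF that(3)] by auto
    then have "(b, a) \<in> crossing V (blk (b mod N))"
      using that by (simp add: crossing_def blk_eq)
    then have "gain {b, a} \<le> key (crossing V (blk (b mod N)))" by (rule gain_le_key[OF finite_crossing])
    also have "\<dots> \<le> g"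
    proof (cases "2 \<le> N")
      case False
      then have "N = 1" using N1 by simp
      then show ?thesis using assms(4) g by simp
    qed (use assms(5) b g in blast)
    finally show ?thesis .
  qed
  obtain y where "y < n" "y \<notin> V" using assms(2,3) by blast
  then obtain a b where ab: "a \<in> V" "b \<notin> V" "{b, a} \<in> E"
    using connected_graph_exit[OF conn assms(2,1)] by blast
  \<comment> \<open>Connectedness supplies a crossing edge, whose positive gain excludes the empty
    alternative in \<open>best\<close>.\<close>
  have "0 < g" using le[OF ab] gain_bounds(1)[OF ab(3)] by simp
  then have uv: "(u, v) \<in> crossing V (blk j)" "g = gain {u, v}"
    using assms(6) by (auto simp: best_def)
  then show "u \<notin> V" "u < n" "v \<in> V" "u mod N = j" and E: "{u, v} \<in> E"
    using assms(4) by (auto simp: crossing_def blk_eq)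
  show "wt {u, v} \<le> wt {b, a}" if "a \<in> V" "b \<notin> V" "{b, a} \<in> E" for a b
    using le[OF that] gain_le_iff[OF that(3) E] uv(2) by simp
qed

section \<open>The main loop\<close>

definition step_cost :: "nat \<Rightarrow> nat \<Rightarrow> nat" where
  "step_cost d u = 10 + 14 * d + blk_cost (u mod N) + add_cost d u"

lemma wp_main_loop:
  "run main_loop Q \<sigma> \<longleftrightarrow> (if regs \<sigma> 5 < regs \<sigma> 0 then
     run (Move 16 (Imm 1) ;; descend_loop ;; Op Sub 9 (Reg 16) (Reg 2) ;;
     Move 8 (Imm 0) ;; scan_loop ;; Output (Reg 6) ;; Output (Reg 7) ;;
     add_vertex ;; Op Add 5 (Reg 5) (Imm 1))
     (\<lambda>t. run main_loop (\<lambda>t'. Q (Suc (t + t')))) \<sigma> else Q (Suc 0) \<sigma>)"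
  unfolding main_loop_def by (rule trans[OF wp_While]) simp

text \<open>The remaining time is charged to the vertices outside the tree, which makes the bound
  independent of the order in which they join.\<close>

lemma main_loop_correct:
  assumes "env \<sigma>" "keys (vis \<sigma>) \<sigma>" "regs \<sigma> 5 = card (vis \<sigma>)" "2 * N \<le> 2 ^ d"
    and "prim_inv n E wt (vis \<sigma>) F" "encodes_edges (outp \<sigma>) F"
  shows "run main_loop (\<lambda>t \<sigma>'. t \<le> 1 + (\<Sum>u\<in>{..<n} - vis \<sigma>. step_cost d u) \<and>
    (\<exists>F'. min_spanning_forest E wt F' \<and> encodes_edges (outp \<sigma>') F')) \<sigma>"
  using assms
proof (induction "n - card (vis \<sigma>)" arbitrary: \<sigma> F rule: less_induct)
  case less
  let ?V = "vis \<sigma>"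
  have V: "0 \<in> ?V" "?V \<subseteq> {..<n}" "finite ?V"
    using less.prems(5) by (auto simp: prim_inv_def subtree_def intro: finite_subset)
  have F: "\<And>e. e \<in> F \<Longrightarrow> e \<subseteq> ?V" using less.prems(5) by (auto simp: prim_inv_def subtree_def)
  have card: "card ?V \<le> n" using card_mono[OF _ V(2)] by simp
  show ?case
  proof (cases "card ?V = n")
    case True
    then have "?V = {..<n}" using V by (intro card_subset_eq) auto
    then have "min_spanning_forest E wt F"
      using prim_inv_final[OF simple conn] n2 less.prems(5) by simp
    then show ?thesis using less.prems(1,3,6) True by (subst wp_main_loop) auto
  next
    case False
    then have lt: "card ?V < n" and VN: "?V \<noteq> {..<n}" using card by (simp, metis card_lessThan)
    have desc: "run descend_loop (\<lambda>t \<sigma>'. t \<le> 1 + 14 * d \<and> env \<sigma>' \<and> vis \<sigma>' = ?V \<and> node \<sigma>' = node \<sigma> \<and> outp \<sigma>' = outp \<sigma> \<and>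
        N \<le> regs \<sigma>' 16 \<and> regs \<sigma>' 16 < 2 * N \<and>
        (2 \<le> N \<longrightarrow> (\<forall>b<N. key (crossing ?V (blk b)) \<le> key (crossing ?V (blk (regs \<sigma>' 16 - N))))) \<and>
        (\<forall>r. r < 6 \<longrightarrow> regs \<sigma>' r = regs \<sigma> r)) \<tau>"
      if \<tau>: "env \<tau>" "vis \<tau> = ?V" "node \<tau> = node \<sigma>" "outp \<tau> = outp \<sigma>" "regs \<tau> 16 = Suc 0"
        "\<And>r. r < 6 \<Longrightarrow> regs \<tau> r = regs \<sigma> r" for \<tau>
    proof (rule wp_mono[OF descend_loop_correct[of \<tau> d]])
      show "heap (node \<tau>) {}" using less.prems(2) \<tau>(3) by (simp add: keys_def)
      fix t \<sigma>'
      assume *: "t \<le> 1 + 14 * d \<and> vis \<sigma>' = vis \<tau> \<and> node \<sigma>' = node \<tau> \<and> outp \<sigma>' = outp \<tau> \<and>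
        N \<le> regs \<sigma>' 16 \<and> regs \<sigma>' 16 < 2 * N \<and>
        (2 \<le> N \<longrightarrow> (\<forall>j. 2 \<le> j \<and> j < 2 * N \<longrightarrow> node \<tau> j \<le> node \<tau> (regs \<sigma>' 16))) \<and>
        (\<forall>r. r < 12 \<longrightarrow> regs \<sigma>' r = regs \<tau> r)"
      have "key (crossing ?V (blk b)) \<le> key (crossing ?V (blk (regs \<sigma>' 16 - N)))" if "2 \<le> N" "b < N" for b
      proof -
        have k: "node \<sigma> (N + c) = key (crossing ?V (blk c))" if "c < N" for c
          using less.prems(2) \<open>2 \<le> N\<close> that by (simp add: keys_def)
        have c: "regs \<sigma>' 16 - N < N" "N + (regs \<sigma>' 16 - N) = regs \<sigma>' 16" using * by auto
        have "node \<sigma> (N + b) \<le> node \<sigma> (regs \<sigma>' 16)" using * that \<tau>(3) by simp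
        then show ?thesis using k[OF that(2)] k[OF c(1)] c(2) by simp
      qed
      moreover have "env \<sigma>'" by (rule env_cong[OF \<tau>(1)]) (use * in simp)
      ultimately show "t \<le> 1 + 14 * d \<and> env \<sigma>' \<and> vis \<sigma>' = ?V \<and> node \<sigma>' = node \<sigma> \<and> outp \<sigma>' = outp \<sigma> \<and>
        N \<le> regs \<sigma>' 16 \<and> regs \<sigma>' 16 < 2 * N \<and>
        (2 \<le> N \<longrightarrow> (\<forall>b<N. key (crossing ?V (blk b)) \<le> key (crossing ?V (blk (regs \<sigma>' 16 - N))))) \<and>
        (\<forall>r. r < 6 \<longrightarrow> regs \<sigma>' r = regs \<sigma> r)"
        using * \<tau> by simp
    qed (use \<tau> N1 less.prems(4) in auto)
    define new where "new = (\<lambda>u v. u \<notin> ?V \<and> u < n \<and> v \<in> ?V \<and> {u, v} \<in> E \<and>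
      (\<forall>a b. a \<in> ?V \<longrightarrow> b \<notin> ?V \<longrightarrow> {b, a} \<in> E \<longrightarrow> wt {u, v} \<le> wt {b, a}))"
    define T where "T = (\<Sum>u\<in>{..<n} - ?V. step_cost d u)"
    have scan: "run scan_loop (\<lambda>t \<sigma>'. t \<le> 1 + blk_cost (regs \<sigma>' 6 mod N) \<and> env \<sigma>' \<and> vis \<sigma>' = ?V \<and>
        node \<sigma>' = node \<sigma> \<and> outp \<sigma>' = outp \<sigma> \<and> new (regs \<sigma>' 6) (regs \<sigma>' 7) \<and>
        (\<forall>r. r < 6 \<longrightarrow> regs \<sigma>' r = regs \<sigma> r)) \<tau>"
      if \<tau>: "env \<tau>" "vis \<tau> = ?V" "node \<tau> = node \<sigma>" "outp \<tau> = outp \<sigma>" "regs \<tau> 8 = 0" "regs \<tau> 9 < N"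
        "2 \<le> N \<longrightarrow> (\<forall>b<N. key (crossing ?V (blk b)) \<le> key (crossing ?V (blk (regs \<tau> 9))))"
        "\<And>r. r < 6 \<Longrightarrow> regs \<tau> r = regs \<sigma> r" for \<tau>
    proof (rule wp_mono[OF scan_loop_correct[OF \<tau>(1) _ refl, of "{}"]])
      show "best {} (regs \<tau> 8) (regs \<tau> 6) (regs \<tau> 7)" using \<tau>(5) by (simp add: best_def)
      fix t \<sigma>'
      assume *: "t \<le> 1 + blk_cost (regs \<tau> 9) \<and> vis \<sigma>' = vis \<tau> \<and> node \<sigma>' = node \<tau> \<and> outp \<sigma>' = outp \<tau> \<and>
        best ({} \<union> crossing (vis \<tau>) (blk (regs \<tau> 9))) (regs \<sigma>' 8) (regs \<sigma>' 6) (regs \<sigma>' 7) \<and>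
        (\<forall>r<6. regs \<sigma>' r = regs \<tau> r) \<and> regs \<sigma>' 16 = regs \<tau> 16"
      then have "best (crossing ?V (blk (regs \<tau> 9))) (regs \<sigma>' 8) (regs \<sigma>' 6) (regs \<sigma>' 7)"
        using \<tau>(2) by simp
      note best_crossing[OF V(1,2) VN \<tau>(6,7) this]
      then have "new (regs \<sigma>' 6) (regs \<sigma>' 7)" "regs \<sigma>' 6 mod N = regs \<tau> 9"
        unfolding new_def by blast+
      moreover have "env \<sigma>'" by (rule env_cong[OF \<tau>(1)]) (use * in simp)
      ultimately show "t \<le> 1 + blk_cost (regs \<sigma>' 6 mod N) \<and> env \<sigma>' \<and> vis \<sigma>' = ?V \<and>
        node \<sigma>' = node \<sigma> \<and> outp \<sigma>' = outp \<sigma> \<and> new (regs \<sigma>' 6) (regs \<sigma>' 7) \<and>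
        (\<forall>r<6. regs \<sigma>' r = regs \<sigma> r)"
        using * \<tau>(2,3,4,8) by simp
    qed
    \<comment> \<open>The time added to \<open>t\<close> is what the current round has spent before
      \<open>add_vertex\<close>: the loop test, the descent, the scan, the two outputs and three
      register operations.\<close>
    have tail: "run (add_vertex ;; Op Add 5 (Reg 5) (Imm (Suc 0)) ;; main_loop)
      (\<lambda>t \<sigma>'. t + 8 + 14 * d + blk_cost (regs \<tau> 6 mod N) \<le> 1 + T \<and>
        (\<exists>F'. min_spanning_forest E wt F' \<and> encodes_edges (outp \<sigma>') F')) \<tau>"
      if \<tau>: "env \<tau>" "vis \<tau> = ?V" "node \<tau> = node \<sigma>" "outp \<tau> = outp \<sigma> @ [regs \<tau> 6, regs \<tau> 7]"
        "new (regs \<tau> 6) (regs \<tau> 7)" "\<And>r. r < 6 \<Longrightarrow> regs \<tau> r = regs \<sigma> r" for \<tau>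
    proof -
      define u v where "u = regs \<tau> 6" and "v = regs \<tau> 7"
      have uv: "u \<notin> ?V" "u < n" "v \<in> ?V" "{u, v} \<in> E"
        "\<And>a b. a \<in> ?V \<Longrightarrow> b \<notin> ?V \<Longrightarrow> {b, a} \<in> E \<Longrightarrow> wt {u, v} \<le> wt {b, a}"
        using \<tau>(5) unfolding new_def u_def v_def by blast+
      define T' where "T' = (\<Sum>u\<in>{..<n} - insert u ?V. step_cost d u)"
      have "{..<n} - ?V = insert u ({..<n} - insert u ?V)" using uv(1,2) by blast
      then have "T = step_cost d u + T'" unfolding T_def T'_def by (metis DiffE finite_Diff
        finite_lessThan insertI1 sum.insert)
      then have T: "T = 10 + 14 * d + blk_cost (u mod N) + add_cost d u + T'"
        by (simp add: step_cost_def)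
      have "{u, v} \<notin> F" using F uv(1) by blast
      then have enc: "encodes_edges (outp \<sigma> @ [u, v]) (insert {u, v} F)"
        using encodes_edges_append less.prems(6) by blast
      have inv: "prim_inv n E wt (insert u ?V) (insert {u, v} F)"
        by (rule prim_inv_step[OF simple less.prems(5) uv(3,1,4,5)])
      have cardu: "card (insert u ?V) = Suc (card ?V)" using V(3) uv(1) by simp
      have IH: "run main_loop (\<lambda>t \<sigma>'. t \<le> 1 + T' \<and>
          (\<exists>F'. min_spanning_forest E wt F' \<and> encodes_edges (outp \<sigma>') F')) \<rho>"
        if \<rho>: "env \<rho>" "vis \<rho> = insert u ?V" "keys (insert u ?V) \<rho>" "regs \<rho> 5 = Suc (card ?V)"
          "outp \<rho> = outp \<sigma> @ [u, v]" for \<rho>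
      proof -
        have "n - card (vis \<rho>) < n - card ?V" using lt \<rho>(2) cardu by simp
        from less.hyps[OF this \<rho>(1) _ _ less.prems(4), of "insert {u, v} F"] show ?thesis
          unfolding T'_def using \<rho> inv enc cardu by simp
      qed
      have add: "run add_vertex (\<lambda>t \<sigma>'. t \<le> add_cost d u \<and> env \<sigma>' \<and> vis \<sigma>' = insert u ?V \<and>
          outp \<sigma>' = outp \<sigma> @ [u, v] \<and> keys (insert u ?V) \<sigma>' \<and> regs \<sigma>' 5 = card ?V) \<tau>"
      proof (rule wp_mono[OF add_vertex_correct[OF \<tau>(1) u_def[symmetric] uv(2) _ less.prems(4)]])
        show "keys (vis \<tau>) \<tau>" using less.prems(2) \<tau>(2,3) by (simp add: keys_def)
        fix t \<sigma>'
        assume *: "t \<le> add_cost d u \<and> vis \<sigma>' = insert u (vis \<tau>) \<and> outp \<sigma>' = outp \<tau> \<and>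
          keys (insert u (vis \<tau>)) \<sigma>' \<and> (\<forall>r<6. regs \<sigma>' r = regs \<tau> r)"
        have "env \<sigma>'" by (rule env_cong[OF \<tau>(1)]) (use * in simp)
        then show "t \<le> add_cost d u \<and> env \<sigma>' \<and> vis \<sigma>' = insert u ?V \<and>
          outp \<sigma>' = outp \<sigma> @ [u, v] \<and> keys (insert u ?V) \<sigma>' \<and> regs \<sigma>' 5 = card ?V"
          using * \<tau>(2,4,6) less.prems(3) u_def v_def by simp
      qed
      have "Suc (card ?V) mod 2 ^ w = Suc (card ?V)" using lt n_w by simp
      moreover have keys_reg: "keys V (set_reg r x \<rho>) = keys V \<rho>" for V r x \<rho> by (simp add: keys_def)
      ultimately show ?thesis
        unfolding T u_def[symmetric] wp_simps
        by (intro wp_mono[OF add]) (simp, rule wp_mono[OF IH]; simp)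
    qed
    have sub: "nat ((int r - int N) mod 2 ^ w) = r - N" if "N \<le> r" "r < 2 * N" for r
    proof -
      have "r < 2 ^ w" using that Nn n_w by linarith
      then show ?thesis using Sub_nat[OF that(1)] by simp
    qed
    have sub_less: "r - N < N" if "N \<le> r" "r < 2 * N" for r using that by linarith
    show ?thesis
      unfolding T_def[symmetric]
      using less.prems(1,3) lt
      apply (subst wp_main_loop)
      apply simp
      apply (rule wp_mono[OF desc]; simp)
      apply (rule wp_mono[OF scan]; simp add: sub sub_less)
      apply (rule wp_seq3_mono[OF tail]; simp)
      done
  qed
qed


section \<open>Total running time\<close>

text \<open>Handshake argument: an edge occurs in at most two lists, and the truth value of
  \<open>u < v\<close> tells these occurrences apart.\<close>

lemma sum_length_A: "(\<Sum>u<n. length (A u)) \<le> 2 * card E"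
proof -
  have "(\<Sum>u<n. length (A u)) = (\<Sum>u<n. card (set (A u)))"
    using A_dist by (intro sum.cong) (auto simp: distinct_card)
  also have "\<dots> = card (Sigma {..<n} (\<lambda>u. set (A u)))" by (simp add: card_SigmaI)
  also have "\<dots> \<le> card (E \<times> (UNIV :: bool set))"
  proof (rule card_inj_on_le)
    show "inj_on (\<lambda>(u, v). ({u, v}, u < v)) (Sigma {..<n} (\<lambda>u. set (A u)))"
      by (auto simp: inj_on_def doubleton_eq_iff)
    show "(\<lambda>(u, v). ({u, v}, u < v)) ` Sigma {..<n} (\<lambda>u. set (A u)) \<subseteq> E \<times> UNIV"
      using A_set by auto
  qed (simp add: simple_graph_finite[OF simple])
  finally show ?thesis by (simp add: card_cartesian_product)
qed

lemma card_blk_le: "card {u. u < n \<and> u mod N = j} \<le> n div N + 1"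
proof -
  have "card {u. u < n \<and> u mod N = j} \<le> card {..n div N}"
  proof (rule card_inj_on_le)
    show "inj_on (\<lambda>u. u div N) {u. u < n \<and> u mod N = j}"
    proof (rule inj_onI)
      fix x y assume "x \<in> {u. u < n \<and> u mod N = j}" "y \<in> {u. u < n \<and> u mod N = j}" "x div N = y div N"
      then show "x = y" using div_mult_mod_eq[of x N] div_mult_mod_eq[of y N] by simp
    qed
    show "(\<lambda>u. u div N) ` {u. u < n \<and> u mod N = j} \<subseteq> {..n div N}"
      by (auto intro: div_le_mono)
  qed simp
  then show ?thesis by simp
qed

text \<open>In this sum a vertex \<open>a\<close> is paid for once per \<open>u\<close> in its
  residue class, so swapping the sums weights its cost with the size of that class.\<close>

lemma sum_blk_cost: "(\<Sum>u<n. blk_cost (u mod N)) \<le> (n div N + 1) * (15 * (n + 2 * card E))"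
proof -
  let ?c = "\<lambda>a. 15 * (1 + length (A a))"
  have "(\<Sum>u<n. blk_cost (u mod N)) = (\<Sum>u<n. \<Sum>a\<in>{..<n}. if a mod N = u mod N then ?c a else 0)"
  proof (rule sum.cong)
    fix u
    have "blk (u mod N) = {a \<in> {..<n}. a mod N = u mod N}" using N1 by (auto simp: blk_eq)
    then show "blk_cost (u mod N) = (\<Sum>a\<in>{..<n}. if a mod N = u mod N then ?c a else 0)"
      unfolding blk_cost_def by (simp only: sum.inter_filter finite_lessThan)
  qed simp
  also have "\<dots> = (\<Sum>a<n. \<Sum>u<n. if a mod N = u mod N then ?c a else 0)" by (rule sum.swap)
  also have "\<dots> = (\<Sum>a<n. card {u. u < n \<and> u mod N = a mod N} * ?c a)"
  proof (rule sum.cong)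
    fix a
    have "(\<Sum>u<n. if a mod N = u mod N then ?c a else 0) = (\<Sum>u\<in>{u \<in> {..<n}. u mod N = a mod N}. ?c a)"
      by (subst sum.inter_filter) (auto intro: sum.cong)
    then show "(\<Sum>u<n. if a mod N = u mod N then ?c a else 0) = card {u. u < n \<and> u mod N = a mod N} * ?c a"
      by simp
  qed simp
  also have "\<dots> \<le> (\<Sum>a<n. (n div N + 1) * ?c a)"
    by (intro sum_mono mult_right_mono card_blk_le) simp
  also have "\<dots> = (n div N + 1) * (15 * (n + (\<Sum>a<n. length (A a))))"
    by (simp add: sum_distrib_left[symmetric] sum.distrib)
  also have "\<dots> \<le> (n div N + 1) * (15 * (n + 2 * card E))"
    using sum_length_A by (intro mult_left_mono) auto
  finally show ?thesis .
qed

lemma sum_step_cost: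
  assumes "1 \<le> d" "n div N + 1 \<le> M"
  shows "(\<Sum>u<n. step_cost d u) \<le> card E * (174 * d + 120 * M)"
proof -
  have m: "n \<le> 2 * card E" using connected_card_ge[OF simple conn] n2 by simp
  have "(\<Sum>u<n. step_cost d u) =
      n * (25 + 27 * d) + (22 + 13 * d) * (\<Sum>u<n. length (A u)) + 2 * (\<Sum>u<n. blk_cost (u mod N))"
    by (simp add: step_cost_def add_cost_def sum.distrib sum_distrib_left algebra_simps)
  \<comment> \<open>From \<open>d >= 1\<close> come \<open>52 * d\<close> and \<open>35 * d\<close>.
    Connectedness gives \<open>n <= 2 * card E\<close>, so \<open>n + 2 * card E\<close> is at most
    \<open>4 * card E\<close>; the factor 2 in front reflects two scans per vertex.\<close>
  also have "\<dots> \<le> (2 * card E) * (52 * d) + (35 * d) * (2 * card E) + 2 * (M * (15 * (4 * card E)))"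
  proof (intro add_mono mult_mono)
    show "(\<Sum>u<n. blk_cost (u mod N)) \<le> M * (15 * (4 * card E))"
      using sum_blk_cost assms(2) m by (elim order_trans, intro mult_mono) auto
  qed (use assms m sum_length_A in auto)
  also have "\<dots> = card E * (174 * d + 120 * M)" by (simp add: algebra_simps)
  finally show ?thesis .
qed

lemma prim_correct:
  assumes "env \<sigma>" "work \<sigma> = (\<lambda>_. False)" "outp \<sigma> = []" "2 * N \<le> 2 ^ d"
  shows "run (Move 5 (Imm 1) ;; Move 6 (Imm 0) ;; add_vertex ;; main_loop)
    (\<lambda>t \<sigma>'. t \<le> 3 + (\<Sum>u<n. step_cost d u) \<and>
      (\<exists>F. min_spanning_forest E wt F \<and> encodes_edges (outp \<sigma>') F)) \<sigma>"
proof -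
  have v: "vis \<sigma> = {}" and nd: "node \<sigma> = (\<lambda>_. 0)"
    using assms(2) by (auto simp: vis_def node_def load_field_def)
  have add: "run add_vertex (\<lambda>t \<sigma>'. t \<le> add_cost d 0 \<and> env \<sigma>' \<and> vis \<sigma>' = {0} \<and> outp \<sigma>' = [] \<and>
      keys {0} \<sigma>' \<and> regs \<sigma>' 5 = 1) \<tau>"
    if \<tau>: "env \<tau>" "vis \<tau> = {}" "node \<tau> = (\<lambda>_. 0)" "outp \<tau> = []" "regs \<tau> 6 = 0" "regs \<tau> 5 = 1" for \<tau>
  proof (rule wp_mono[OF add_vertex_correct[OF \<tau>(1,5) _ _ assms(4)]])
    show "keys (vis \<tau>) \<tau>" using \<tau>(2,3) by (simp add: keys_def heap_def crossing_def)
    fix t \<sigma>'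
    assume *: "t \<le> add_cost d 0 \<and> vis \<sigma>' = insert 0 (vis \<tau>) \<and> outp \<sigma>' = outp \<tau> \<and>
      keys (insert 0 (vis \<tau>)) \<sigma>' \<and> (\<forall>r<6. regs \<sigma>' r = regs \<tau> r)"
    have "env \<sigma>'" by (rule env_cong[OF \<tau>(1)]) (use * in simp)
    then show "t \<le> add_cost d 0 \<and> env \<sigma>' \<and> vis \<sigma>' = {0} \<and> outp \<sigma>' = [] \<and> keys {0} \<sigma>' \<and> regs \<sigma>' 5 = 1"
      using * \<tau>(2,4,6) by simp
  qed (use n2 in simp)
  define T where "T = (\<Sum>u\<in>{..<n} - {0}. step_cost d u)"
  have main: "run main_loop (\<lambda>t \<sigma>'. t \<le> 1 + T \<and>
      (\<exists>F. min_spanning_forest E wt F \<and> encodes_edges (outp \<sigma>') F)) \<tau>"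
    if \<tau>: "env \<tau>" "vis \<tau> = {0}" "keys {0} \<tau>" "regs \<tau> 5 = 1" "outp \<tau> = []" for \<tau>
  proof -
    have "encodes_edges [] {}" by (simp add: encodes_edges_def)
    moreover have "prim_inv n E wt {0} {}" using prim_inv_start n2 by simp
    ultimately show ?thesis
      using main_loop_correct[OF \<tau>(1) _ _ assms(4), of "{}"] \<tau> by (simp add: T_def)
  qed
  \<comment> \<open>Vertex 0 joins without a search, but charging it a full step lets the sum range
    over all vertices.\<close>
  have "(\<Sum>u<n. step_cost d u) = step_cost d 0 + T"
    unfolding T_def using n2 by (intro sum.remove) auto
  then have T: "(\<Sum>u<n. step_cost d u) = 10 + 14 * d + blk_cost 0 + add_cost d 0 + T"
    by (simp add: step_cost_def)
  show ?thesis
    unfolding T using assms(1,3) v nd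
    apply simp
    apply (rule wp_mono[OF add]; simp)
    apply (rule wp_mono[OF main]; simp)
    done
qed

end

section \<open>Explicit parameters and word length\<close>

lemma prim_run:
  assumes n2: "2 \<le> n" and simple: "simple_graph n E" and conn: "connected_graph n E"
    and adj: "adjacency_list w I n E wt" and k: "1 \<le> k" "k \<le> n" and K: "1 \<le> K"
    and L: "2 ^ (L - 1) \<le> n" "n < 2 ^ L" and w: "n ^ (2 * K + 10) \<le> 2 ^ w"
    and wt: "\<And>e. e \<in> E \<Longrightarrow> \<bar>wt e\<bar> < 2 ^ (K * L - 1)"
  shows "\<exists>s t \<sigma> F. exec w s I (prim K) (init_state n k) t \<sigma> \<and> encodes_edges (outp \<sigma>) F \<and>
    min_spanning_forest E wt F \<and> s * k \<le> n * k + 2 * n \<and> t \<le> (375 + 360 * K) * (card E * L * k)"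
proof -
  define l where "l = K * L"
  define N where "N = max 1 (n div (k * l))"
  define s where "s = n + (2 * N - 2) * l"
  have L2: "2 \<le> L"
  proof (rule ccontr)
    assume "\<not> 2 \<le> L"
    then have "(2::nat) ^ L \<le> 2 ^ 1" by (intro power_increasing) auto
    then show False using L(2) n2 by simp
  qed
  have l: "1 \<le> l" using K L2 by (simp add: l_def)
  have "L - 1 < 2 ^ (L - 1)" by (rule less_exp)
  then have Ln: "L \<le> n" using L(1) by linarith
  have pow: "n ^ i < 2 ^ w" if "i < 2 * K + 10" for i
    using power_strict_increasing[OF that, of n] n2 w by linarith
  have n3: "4 * n \<le> n ^ 3"
    using mult_mono[OF mult_mono[OF n2 n2] order_refl[of n]] by (simp add: power3_eq_cube)
  have n_w: "4 * n < 2 ^ w" using n3 pow[of 3] by linarith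
  \<comment> \<open>\<open>2 ^ (L - 1) <= n\<close> turns the word bound into
    \<open>(L - 1) * (2 * K + 10) <= w\<close>; since \<open>L >= 2\<close>, \<open>L\<close> is at
    most \<open>2 * (L - 1)\<close>, which is why the exponent contains
    \<open>2 * K\<close>.\<close>
  have lw: "l \<le> w"
  proof -
    have "(2::nat) ^ ((L - 1) * (2 * K + 10)) \<le> n ^ (2 * K + 10)"
      using L(1) by (simp only: power_mult power_mono)
    also note w
    finally have "(L - 1) * (2 * K + 10) \<le> w" by (rule power_le_imp_le_exp[rotated]) simp
    moreover have "l \<le> (L - 1) * (2 * K)"
    proof -
      have "K * L \<le> K * (2 * (L - 1))" using L2 by (intro mult_left_mono) auto
      then show ?thesis by (simp add: l_def algebra_simps)
    qed
    moreover have "(L - 1) * (2 * K) \<le> (L - 1) * (2 * K + 10)" by (intro mult_left_mono) auto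
    ultimately show ?thesis by linarith
  qed
  have kl: "k * l < 2 ^ w"
  proof -
    have "K \<le> n ^ K" using less_exp[of K] power_mono[OF n2, of K] by linarith
    then have "k * (K * L) \<le> n * (n ^ K * n)" using k(2) Ln by (intro mult_mono) auto
    also have "\<dots> = n ^ (K + 2)" by simp
    also have "\<dots> < 2 ^ w" by (rule pow) simp
    finally show ?thesis by (simp add: l_def)
  qed
  \<comment> \<open>Multiplied by \<open>k\<close>, the size of the tree is bounded without
    division. If the quotient is 0, then \<open>N = 1\<close> and the tree takes no bits.\<close>
  have Nkl: "(2 * N - 2) * l * k \<le> 2 * n"
  proof (cases "n div (k * l) = 0")
    case False
    then have "N = n div (k * l)" by (simp add: N_def)
    then have "N * (k * l) \<le> n" by simp
    moreover have "(2 * N - 2) * (l * k) \<le> (2 * N) * (l * k)" by (intro mult_right_mono) auto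
    ultimately show ?thesis by (simp add: algebra_simps)
  qed (simp add: N_def)
  have "(2 * N - 2) * l \<le> (2 * N - 2) * l * k" using k(1) by simp
  then have s: "s \<le> 3 * n" using Nkl unfolding s_def by linarith
  have Nn: "N \<le> n" using n2 by (simp add: N_def)
  \<comment> \<open>A block has \<open>O(k * l)\<close> vertices: a single block is used only if
    \<open>n < k * l\<close>, and otherwise rounding costs at most a factor 2 because
    \<open>N + 1 <= 2 * N\<close>.\<close>
  have M: "n div N + 1 \<le> 3 * (k * l)"
  proof (cases "n div (k * l) = 0")
    case True
    then have "n < k * l" using k(1) l by (simp add: div_eq_0_iff)
    then show ?thesis using True by (simp add: N_def)
  next
    case False
    then have N: "N = n div (k * l)" by (simp add: N_def)
    have "n < (N + 1) * (k * l)" using N k(1) l by (metis add.commute div_less_iff_less_mult less_add_one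
      mult_pos_pos less_le_trans zero_less_one)
    also have "\<dots> \<le> (2 * N) * (k * l)" using N_def by (intro mult_right_mono) auto
    finally have "n < 2 * (k * l) * N" by (simp add: algebra_simps)
    then have "n div N < 2 * (k * l)" by (rule less_mult_imp_div_less)
    then show ?thesis by linarith
  qed
  from adj have I_word: "n < 2 ^ w" and "\<forall>u. \<exists>vs. u < n \<longrightarrow> distinct vs \<and> set vs = {v. {u, v} \<in> E} \<and>
      linked_list w I n (I u) (map (\<lambda>v. (v, signed_word w (wt {u, v}))) vs)"
    unfolding adjacency_list_def by auto
  from choice[OF this(2)] obtain A where A: "\<And>u. u < n \<Longrightarrow> distinct (A u) \<and> set (A u) = {v. {u, v} \<in> E} \<and>
      linked_list w I n (I u) (map (\<lambda>v. (v, signed_word w (wt {u, v}))) (A u))"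
    by blast
  interpret prim_ram n E wt w s I N l "2 ^ (l - 1)" A
  proof
    show "2 * n < 2 ^ w" "s < 2 ^ w" using n_w s by linarith+
    show "\<bar>wt e\<bar> < int (2 ^ (l - 1))" if "e \<in> E" for e using wt[OF that] by (simp add: l_def)
  qed (use n2 simple conn s_def Nn l lw A in \<open>simp_all add: N_def\<close>)
  have d: "2 * N \<le> 2 ^ (L + 1)" using Nn L(2) by simp
  have start: "run (setup_regs K) (\<lambda>t \<sigma>. t \<le> 20 + 3 * L \<and> env \<sigma> \<and> work \<sigma> = (\<lambda>_. False) \<and> outp \<sigma> = [])
    (init_state n k)"
    unfolding env_def
    by (rule wp_mono[OF setup_regs_correct[OF L(2,1) n2 K k(1) kl[unfolded l_def] lw[unfolded l_def] I_word pow_w]])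
      (simp add: N_def l_def)
  have "run (setup_regs K ;; Move 5 (Imm 1) ;; Move 6 (Imm 0) ;; add_vertex ;; main_loop)
    (\<lambda>t \<sigma>. t \<le> 23 + 3 * L + (\<Sum>u<n. step_cost (L + 1) u) \<and>
      (\<exists>F. min_spanning_forest E wt F \<and> encodes_edges (outp \<sigma>) F)) (init_state n k)"
    unfolding wp_simps(8)[of w s I "setup_regs K"]
  proof (rule wp_mono[OF start])
    fix t \<sigma>
    assume *: "t \<le> 20 + 3 * L \<and> env \<sigma> \<and> work \<sigma> = (\<lambda>_. False) \<and> outp \<sigma> = []"
    show "run (Move 5 (Imm 1) ;; Move 6 (Imm 0) ;; add_vertex ;; main_loop)
      (\<lambda>t' \<sigma>. t + t' \<le> 23 + 3 * L + (\<Sum>u<n. step_cost (L + 1) u) \<and>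
        (\<exists>F. min_spanning_forest E wt F \<and> encodes_edges (outp \<sigma>) F)) \<sigma>"
      by (rule wp_mono[OF prim_correct[OF _ _ _ d]]) (use * in auto)
  qed
  then have "run (prim K) (\<lambda>t \<sigma>. t \<le> 24 + 3 * L + (\<Sum>u<n. step_cost (L + 1) u) \<and>
      (\<exists>F. min_spanning_forest E wt F \<and> encodes_edges (outp \<sigma>) F)) (init_state n k)"
    unfolding prim_def wp_simps(9) using n2
    by (simp add: init_state_def add.assoc del: wp_simps)
  then obtain t \<sigma> F where tF: "exec w s I (prim K) (init_state n k) t \<sigma>"
    "t \<le> 24 + 3 * L + (\<Sum>u<n. step_cost (L + 1) u)" "min_spanning_forest E wt F"
    "encodes_edges (outp \<sigma>) F"
    by (elim wpE) blast
  have m: "1 \<le> card E" using connected_card_ge[OF simple conn] n2 by simp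
  define X where "X = card E * L * k"
  have mX: "1 \<le> X" "L \<le> X" "card E \<le> X" "card E * L \<le> X"
    using m L2 k(1) by (auto simp: X_def)
  have "(\<Sum>u<n. step_cost (L + 1) u) \<le> card E * (174 * (L + 1) + 120 * (3 * (k * l)))"
    by (rule sum_step_cost[OF _ M]) simp
  also have "\<dots> = 174 * (card E * L) + 174 * card E + 360 * K * X"
    by (simp add: X_def l_def algebra_simps)
  finally have "t \<le> 24 + 3 * L + (174 * (card E * L) + 174 * card E + 360 * K * X)" using tF(2) by linarith
  \<comment> \<open>The constant is \<open>24 + 3 + 174 + 174 = 375\<close>, all lower-order terms
    being absorbed by \<open>X\<close>.\<close>
  also have "\<dots> \<le> 375 * X + 360 * K * X" using mX by linarith
  also have "\<dots> = (375 + 360 * K) * X" by (simp add: algebra_simps)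
  finally have "t \<le> (375 + 360 * K) * (card E * L * k)" by (simp add: X_def)
  moreover have "s * k \<le> n * k + 2 * n" using Nkl by (simp add: s_def algebra_simps)
  ultimately show ?thesis using tF by blast
qed

text \<open>As \<open>lg 1 = 0\<close>, the relation between \<open>w\<close> and
  \<open>lg n\<close> gives no room for arithmetic here; the guard of \<open>prim\<close> stops at
  once with empty output.\<close>

lemma prim_run_single:
  assumes "simple_graph 1 E" "adjacency_list w I 1 E wt"
  shows "\<exists>t \<sigma>. exec w 0 I (prim K) (init_state 1 k) t \<sigma> \<and> encodes_edges (outp \<sigma>) {} \<and>
    min_spanning_forest E wt {}"
proof -
  have "E = {}"
  proof -
    have "card e \<le> 1" if "e \<in> E" for e
      using assms(1) that card_mono[of "{..<1::nat}" e] by (simp add: simple_graph_def)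
    then show ?thesis using assms(1) by (fastforce simp: simple_graph_def)
  qed
  moreover have "forest {}" by (fastforce simp: forest_def is_cycle_def)
  ultimately have "min_spanning_forest E wt {}"
    by (auto simp: min_spanning_forest_def spanning_forest_def)
  moreover have "1 < (2::nat) ^ w" using assms(2) by (simp add: adjacency_list_def)
  then have "w \<noteq> 0" by (intro notI) simp
  then have "wp w 0 I (prim K) (\<lambda>t \<sigma>. encodes_edges (outp \<sigma>) {}) (init_state 1 k)"
    by (simp add: prim_def init_state_def encodes_edges_def)
  ultimately show ?thesis by (auto elim!: wpE)
qed

section \<open>From explicit bounds to the asymptotic statement\<close>

lemma ex_bit_length:
  fixes n :: nat
  assumes "1 \<le> n"
  obtains L where "2 ^ (L - 1) \<le> n" "n < 2 ^ L" "1 \<le> L"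
proof -
  define L where "L = (LEAST L. n < 2 ^ L)"
  have L: "n < 2 ^ L" unfolding L_def by (rule LeastI[of _ n]) (rule less_exp)
  then have "1 \<le> L" using assms by (cases L) auto
  moreover from this have "\<not> n < 2 ^ (L - 1)" unfolding L_def by (intro not_less_Least) simp
  ultimately show thesis using that[of L] L by simp
qed

theorem theorem10:
  fixes f :: "nat \<Rightarrow> real" and c :: real
  assumes "\<And>n. 1 \<le> n \<Longrightarrow> 1 \<le> f n \<and> f n \<le> real n"
  shows "\<exists>P b C D. 0 < b \<and> 0 < C \<and> 0 < D \<and>
    (\<forall>n E wt w I.
      1 \<le> n \<and> simple_graph n E \<and> connected_graph n E \<and>
      (\<forall>e\<in>E. real_of_int \<bar>wt e\<bar> < 2 powr (c * log 2 (real n))) \<and>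
      b * log 2 (real n) \<le> real w \<and> adjacency_list w I n E wt \<longrightarrow>
      (\<exists>s t \<sigma> F.
        exec w s I P (init_state n (nat \<lfloor>f n\<rfloor>)) t \<sigma> \<and>
        encodes_edges (outp \<sigma>) F \<and> min_spanning_forest E wt F \<and>
        real s \<le> real n + C * (real n / f n) \<and>
        (2 \<le> n \<longrightarrow> real t \<le> D * (real (card E) * log 2 (real n) * f n))))"
proof -
  \<comment> \<open>Keys get \<open>K * L\<close> bits. The 1 added to the ceiling makes room for
    the offset: \<open>c * lg n <= (K - 1) * L <= K * L - 1\<close> puts all weights below
    \<open>h\<close> in absolute value, also for negative \<open>c\<close>.\<close>
  define K where "K = nat \<lceil>max c 0\<rceil> + 1"
  have K: "1 \<le> K" "max c 0 + 1 \<le> real K" unfolding K_def by linarith+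
  define b where "b = real (2 * K + 10)"
  \<comment> \<open>The factor 2 comes from \<open>L <= lg n + 1 <= 2 * lg n\<close>.\<close>
  define D where "D = 2 * real (375 + 360 * K)"
  have main: "\<exists>s t \<sigma> F.
      exec w s I (prim K) (init_state n (nat \<lfloor>f n\<rfloor>)) t \<sigma> \<and>
      encodes_edges (outp \<sigma>) F \<and> min_spanning_forest E wt F \<and>
      real s \<le> real n + 4 * (real n / f n) \<and>
      (2 \<le> n \<longrightarrow> real t \<le> D * (real (card E) * log 2 (real n) * f n))"
    if n1: "1 \<le> n" and simple: "simple_graph n E" and conn: "connected_graph n E"
      and wt: "\<forall>e\<in>E. real_of_int \<bar>wt e\<bar> < 2 powr (c * log 2 (real n))"
      and w: "b * log 2 (real n) \<le> real w" and adj: "adjacency_list w I n E wt" for n E wt w I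
  proof (cases "n = 1")
    case True
    then obtain t \<sigma> where "exec w 0 I (prim K) (init_state n (nat \<lfloor>f n\<rfloor>)) t \<sigma>"
      "encodes_edges (outp \<sigma>) {}" "min_spanning_forest E wt {}"
      using prim_run_single simple adj by blast
    moreover have "0 \<le> f n" using assms[OF n1] by linarith
    ultimately show ?thesis using True by (intro exI[of _ 0] exI[of _ t] exI[of _ \<sigma>] exI[of _ "{}"]) simp
  next
    case False
    then have n2: "2 \<le> n" using n1 by simp
    obtain L where L: "2 ^ (L - 1) \<le> n" "n < 2 ^ L" "1 \<le> L" using ex_bit_length[OF n1] .
    have log1: "1 \<le> log 2 (real n)" using n2 by simp
    have logL: "real L - 1 \<le> log 2 (real n)" "log 2 (real n) \<le> real L"
    proof -
      have "2 powr real (L - 1) \<le> real n" using L(1) by (simp add: powr_realpow flip: of_nat_le_iff)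
      then have "real (L - 1) \<le> log 2 (real n)" using n1 by (simp add: le_log_iff)
      then show "real L - 1 \<le> log 2 (real n)" using L(3) by simp
      have "real n \<le> 2 powr real L" using L(2) by (simp add: powr_realpow flip: of_nat_le_iff)
      then show "log 2 (real n) \<le> real L" using n1 by (simp add: log_le_iff)
    qed
    define k where "k = nat \<lfloor>f n\<rfloor>"
    have f: "1 \<le> f n" "f n \<le> real n" using assms[OF n1] by auto
    have k: "1 \<le> k" "k \<le> n" "real k \<le> f n" "f n \<le> 2 * real k"
    proof -
      have "1 \<le> \<lfloor>f n\<rfloor>" using f(1) by simp
      then have k': "real k = real_of_int \<lfloor>f n\<rfloor>" by (simp add: k_def)
      show "1 \<le> k" using \<open>1 \<le> \<lfloor>f n\<rfloor>\<close> unfolding k_def by linarith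
      show "real k \<le> f n" using k' by simp
      then show "k \<le> n" using f(2) by simp
      \<comment> \<open>Rounding \<open>f n >= 1\<close> down loses at most a factor 2, so
        \<open>2 * n / k\<close> becomes \<open>4 * n / f n\<close> in the space bound.\<close>
      show "f n \<le> 2 * real k" using k' \<open>1 \<le> k\<close> by linarith
    qed
    have "real n ^ (2 * K + 10) = 2 powr (b * log 2 (real n))"
    proof -
      have "2 powr (b * log 2 (real n)) = (2 powr log 2 (real n)) powr b"
        by (simp add: powr_powr mult.commute)
      also have "\<dots> = real n powr b" using n1 by simp
      also have "\<dots> = real n ^ (2 * K + 10)" unfolding b_def using n1 by (intro powr_realpow) simp
      finally show ?thesis ..
    qed
    also have "\<dots> \<le> 2 powr real w" using w by simp
    finally have "real (n ^ (2 * K + 10)) \<le> real (2 ^ w)" by (simp add: powr_realpow)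
    then have w': "n ^ (2 * K + 10) \<le> 2 ^ w" by (simp only: of_nat_le_iff)
    have wt': "\<bar>wt e\<bar> < 2 ^ (K * L - 1)" if "e \<in> E" for e
    proof -
      have KL: "1 \<le> K * L" using K(1) L(3) by simp
      have "c * log 2 (real n) \<le> max c 0 * real L"
        using log1 logL(2) by (intro mult_mono) auto
      also have "\<dots> \<le> (real K - 1) * real L" using K(2) by (intro mult_right_mono) auto
      also have "\<dots> \<le> real (K * L - 1)" using L(3) KL by (simp add: algebra_simps of_nat_diff)
      finally have "2 powr (c * log 2 (real n)) \<le> 2 powr real (K * L - 1)" by simp
      then have "real_of_int \<bar>wt e\<bar> < 2 ^ (K * L - 1)"
        using wt that by (force simp: powr_realpow)
      then show ?thesis by (metis of_int_less_numeral_power_cancel_iff)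
    qed
    obtain s t \<sigma> F where run: "exec w s I (prim K) (init_state n k) t \<sigma>" "encodes_edges (outp \<sigma>) F"
      "min_spanning_forest E wt F" and s: "s * k \<le> n * k + 2 * n"
      and t: "t \<le> (375 + 360 * K) * (card E * L * k)"
      using prim_run[OF n2 simple conn adj k(1,2) K(1) L(1,2) w' wt'] by blast
    have "real s * real k \<le> real n * real k + 2 * real n"
      using s by (simp flip: of_nat_mult of_nat_add of_nat_le_iff add: of_nat_le_iff[symmetric, where 'a = real])
    then have "real s \<le> real n + 2 * real n / real k" using k(1) by (simp add: field_simps)
    also have "2 * real n / real k \<le> 4 * (real n / f n)"
      using mult_left_mono[OF k(4), of "real n"] k(1) f(1) by (simp add: field_simps)
    finally have s': "real s \<le> real n + 4 * (real n / f n)" by simp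
    have "real t \<le> real (375 + 360 * K) * (real (card E) * real L * real k)"
      using t by (metis of_nat_le_iff of_nat_mult)
    also have "\<dots> \<le> real (375 + 360 * K) * (real (card E) * (2 * log 2 (real n)) * f n)"
      using log1 logL k(3) by (intro mult_left_mono mult_mono) auto
    finally have "real t \<le> D * (real (card E) * log 2 (real n) * f n)" by (simp add: D_def algebra_simps)
    then show ?thesis using run s' unfolding k_def by blast
  qed
  show ?thesis
    by (intro exI[of _ "prim K"] exI[of _ b] exI[of _ 4] exI[of _ D]) (use main in \<open>auto simp: b_def D_def\<close>)
qed

end
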